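(* Let $n\ge1$ and let $(M,\omega)$ be an $n$-plectic manifold with admissible bundle $A\subset\wedge^nT^*M$. Define $\omega^\natural:A\to TM$ by $\omega^\natural(\alpha)=X_\alpha$ and define a bracket on $\Gamma(A)$ by $$[\alpha,\beta]_\omega=L_{X_\alpha}\beta-L_{X_\beta}\alpha-d\,i_{X_\alpha}i_{X_\beta}\omega .$$ Then $(A,[\cdot,\cdot]_\omega,\omega^\natural)$ is a Lie algebroid over $M$ with anchor $\omega^\natural$.
   Context: An $n$-plectic manifold $(M,\omega)$ is a smooth manifold $M$ with an $(n+1)$-form $\omega$ that is closed ($d\omega=0$) and nondegenerate: for every $x\in M$ and $X\in T_xM$, $i_X\omega=0$ implies $X=0$. An $n$-form $\alpha\in\Omega^n(M)$ is admissible if there is a vector field $X_\alpha$ with $\alpha=i_{X_\alpha}\omega$; $X_\alpha$ is unique by nondegeneracy. The admissible $n$-forms are exactly the sections of a subbundle $A$ of $\wedge^nT^*M$ (the image of the injective bundle map $TM\to\wedge^nT^*M$, $X\mapsto i_X\omega$), called the admissible bundle. *)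

theory Defs
  imports "HOL-Analysis.Analysis" "HOL-Library.Function_Algebras"
begin

section \<open>Functions into a real vector space\<close>

instantiation "fun" :: (type, real_vector) real_vector
begin

definition scaleR_fun :: "real \<Rightarrow> ('a \<Rightarrow> 'b) \<Rightarrow> 'a \<Rightarrow> 'b"
  where "scaleR_fun r f = (\<lambda>x. r *\<^sub>R f x)"

instance
  by standard (auto simp: scaleR_fun_def fun_eq_iff scaleR_add_right scaleR_add_left)

end


section \<open>Smooth manifolds\<close>

text \<open>To be used on open sets of finite-dimensional spaces only, where it says that \<open>f\<close> is
  of class \<open>C\<^sup>n\<close>.\<close>

primrec higher_differentiable_on ::
  "'e::real_normed_vector set \<Rightarrow> ('e \<Rightarrow> 'f::real_normed_vector) \<Rightarrow> nat \<Rightarrow> bool"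
  where
    "higher_differentiable_on S f 0 \<longleftrightarrow> continuous_on S f"
  | "higher_differentiable_on S f (Suc n) \<longleftrightarrow>
       (\<forall>x\<in>S. f differentiable (at x)) \<and>
       (\<forall>v. higher_differentiable_on S (\<lambda>x. frechet_derivative f (at x) v) n)"

definition smooth_on :: "'e::real_normed_vector set \<Rightarrow> ('e \<Rightarrow> 'f::real_normed_vector) \<Rightarrow> bool"
  where "smooth_on S f \<longleftrightarrow> (\<forall>n. higher_differentiable_on S f n)"

text \<open>A chart is a pair of a domain and a coordinate map; the values of the coordinate map
  outside the domain are irrelevant.\<close>

type_synonym ('a, 'e) chart = "'a set \<times> ('a \<Rightarrow> 'e)"

abbreviation cdom :: "('a, 'e) chart \<Rightarrow> 'a set" where "cdom c \<equiv> fst c"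

abbreviation cmap :: "('a, 'e) chart \<Rightarrow> 'a \<Rightarrow> 'e" where "cmap c \<equiv> snd c"

definition cinv :: "('a, 'e) chart \<Rightarrow> 'e \<Rightarrow> 'a"
  where "cinv c = inv_into (cdom c) (cmap c)"

text \<open>The manifold is the type \<open>'a\<close> with its topology (Hausdorff and second countable by its
  sort) and the smooth structure given by an atlas, which need not be maximal. The model space
  \<open>'e\<close> stands for $\mathbb{R}^m$. It is a finite-dimensional inner product space; the class
  \<open>euclidean_space\<close> would exclude the dimension $m = 0$.\<close>

definition smooth_manifold ::
  "('a::{t2_space,second_countable_topology}, 'e::real_inner) chart set \<Rightarrow> bool"
  where
    "smooth_manifold atlas \<longleftrightarrow>
       (\<exists>B::'e set. finite B \<and> span B = UNIV) \<and>
       (\<Union>c\<in>atlas. cdom c) = UNIV \<and>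
       (\<forall>c\<in>atlas. open (cdom c) \<and> open (cmap c ` cdom c) \<and>
          homeomorphism (cdom c) (cmap c ` cdom c) (cmap c) (cinv c)) \<and>
       (\<forall>c\<in>atlas. \<forall>d\<in>atlas.
          smooth_on (cmap c ` (cdom c \<inter> cdom d)) (cmap d \<circ> cinv c))"

definition charts_at :: "('a, 'e) chart set \<Rightarrow> 'a \<Rightarrow> ('a, 'e) chart set"
  where "charts_at atlas x = {c\<in>atlas. x \<in> cdom c}"

text \<open>An arbitrary chart around \<open>x\<close>, used to evaluate at \<open>x\<close> coordinate expressions which do not
  depend on the chart.\<close>

definition chart_of :: "('a, 'e) chart set \<Rightarrow> 'a \<Rightarrow> ('a, 'e) chart"
  where "chart_of atlas x = (SOME c. c \<in> charts_at atlas x)"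

definition smooth_fun_on ::
  "('a, 'e::real_normed_vector) chart set \<Rightarrow> 'a set \<Rightarrow> ('a \<Rightarrow> real) \<Rightarrow> bool"
  where "smooth_fun_on atlas U f \<longleftrightarrow>
    (\<forall>c\<in>atlas. smooth_on (cmap c ` (U \<inter> cdom c)) (f \<circ> cinv c))"


section \<open>Tangent vectors and vector fields\<close>

text \<open>A tangent vector at \<open>x\<close> assigns to every chart around \<open>x\<close> its vector of components, and
  components in different charts are related by the derivative of the coordinate change. The
  components in charts not containing \<open>x\<close> are set to \<open>0\<close>, so that the tangent space is a linear
  subspace of the type \<open>('a, 'e) tvector\<close>.\<close>

type_synonym ('a, 'e) tvector = "('a, 'e) chart \<Rightarrow> 'e"

definition tangent_space ::
  "('a, 'e::real_normed_vector) chart set \<Rightarrow> 'a \<Rightarrow> ('a, 'e) tvector set"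
  where
    "tangent_space atlas x =
       {v. (\<forall>c. c \<notin> charts_at atlas x \<longrightarrow> v c = 0) \<and>
           (\<forall>c\<in>charts_at atlas x. \<forall>d\<in>charts_at atlas x.
              v d = frechet_derivative (cmap d \<circ> cinv c) (at (cmap c x)) (v c))}"

text \<open>The tangent vector at \<open>x\<close> whose components in the chart \<open>c\<close> are \<open>u\<close>.\<close>

definition coord_vector ::
  "('a, 'e::real_normed_vector) chart set \<Rightarrow> ('a, 'e) chart \<Rightarrow> 'a \<Rightarrow> 'e \<Rightarrow> ('a, 'e) tvector"
  where
    "coord_vector atlas c x u =
       (\<lambda>d. if d \<in> charts_at atlas x
            then frechet_derivative (cmap d \<circ> cinv c) (at (cmap c x)) u else 0)"

definition smooth_vector_field_on ::
  "('a, 'e::real_normed_vector) chart set \<Rightarrow> 'a set \<Rightarrow> ('a \<Rightarrow> ('a, 'e) tvector) \<Rightarrow> bool"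
  where
    "smooth_vector_field_on atlas U X \<longleftrightarrow>
       (\<forall>x\<in>U. X x \<in> tangent_space atlas x) \<and>
       (\<forall>c\<in>atlas. smooth_on (cmap c ` (U \<inter> cdom c)) (\<lambda>p. X (cinv c p) c))"

definition tangent_deriv ::
  "('a, 'e::real_normed_vector) chart set \<Rightarrow> 'a \<Rightarrow> ('a, 'e) tvector \<Rightarrow> ('a \<Rightarrow> real) \<Rightarrow> real"
  where
    "tangent_deriv atlas x v f =
       (let c = chart_of atlas x in frechet_derivative (f \<circ> cinv c) (at (cmap c x)) (v c))"

definition field_bracket ::
  "('a, 'e::real_normed_vector) chart set \<Rightarrow> ('a \<Rightarrow> ('a, 'e) tvector) \<Rightarrow>
     ('a \<Rightarrow> ('a, 'e) tvector) \<Rightarrow> 'a \<Rightarrow> ('a, 'e) tvector"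
  where
    "field_bracket atlas X Y x =
       (\<lambda>c. if c \<in> charts_at atlas x
            then frechet_derivative (\<lambda>p. Y (cinv c p) c) (at (cmap c x)) (X x c)
               - frechet_derivative (\<lambda>p. X (cinv c p) c) (at (cmap c x)) (Y x c)
            else 0)"


section \<open>Differential forms\<close>

text \<open>Alternating \<open>k\<close>-linear forms on a linear subspace \<open>V\<close>, as functions on lists which vanish on
  everything but the lists of length \<open>k\<close> of elements of \<open>V\<close>.\<close>

definition alternating_forms :: "nat \<Rightarrow> 'v::real_vector set \<Rightarrow> ('v list \<Rightarrow> real) set"
  where
    "alternating_forms k V =
       {f. (\<forall>vs. \<not> (length vs = k \<and> set vs \<subseteq> V) \<longrightarrow> f vs = 0) \<and>
           (\<forall>xs ys u v a b. Suc (length xs + length ys) = k \<longrightarrow>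
              set xs \<subseteq> V \<longrightarrow> set ys \<subseteq> V \<longrightarrow> u \<in> V \<longrightarrow> v \<in> V \<longrightarrow>
              f (xs @ (a *\<^sub>R u + b *\<^sub>R v) # ys) = a * f (xs @ u # ys) + b * f (xs @ v # ys)) \<and>
           (\<forall>vs. \<not> distinct vs \<longrightarrow> f vs = 0)}"

type_synonym ('a, 'e) covector = "('a, 'e) tvector list \<Rightarrow> real"

type_synonym ('a, 'e) dform = "'a \<Rightarrow> ('a, 'e) covector"

text \<open>The coordinate expression of a form: its value, at the point with coordinates \<open>p\<close>, on the
  coordinate vector fields of the chart \<open>c\<close> with constant components \<open>us\<close>.\<close>

definition local_form ::
  "('a, 'e::real_normed_vector) chart set \<Rightarrow> ('a, 'e) chart \<Rightarrow> ('a, 'e) dform \<Rightarrow>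
     'e \<Rightarrow> 'e list \<Rightarrow> real"
  where "local_form atlas c \<alpha> p us =
    \<alpha> (cinv c p) (map (coord_vector atlas c (cinv c p)) us)"

definition smooth_form_on ::
  "('a, 'e::real_normed_vector) chart set \<Rightarrow> nat \<Rightarrow> 'a set \<Rightarrow> ('a, 'e) dform \<Rightarrow> bool"
  where
    "smooth_form_on atlas k U \<alpha> \<longleftrightarrow>
       (\<forall>x\<in>U. \<alpha> x \<in> alternating_forms k (tangent_space atlas x)) \<and>
       (\<forall>c\<in>atlas. \<forall>us. length us = k \<longrightarrow>
          smooth_on (cmap c ` (U \<inter> cdom c)) (\<lambda>p. local_form atlas c \<alpha> p us))"

definition contract :: "'v \<Rightarrow> ('v list \<Rightarrow> real) \<Rightarrow> 'v list \<Rightarrow> real"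
  where "contract v w = (\<lambda>vs. w (v # vs))"

definition interior_product ::
  "('a \<Rightarrow> ('a, 'e) tvector) \<Rightarrow> ('a, 'e) dform \<Rightarrow> ('a, 'e) dform"
  where "interior_product X \<alpha> = (\<lambda>x. contract (X x) (\<alpha> x))"

text \<open>In coordinates,
  $(d\alpha)(u_0,\dots,u_k) =
     \sum_i (-1)^i\, \partial_{u_i}(\alpha(u_0,\dots,\widehat{u_i},\dots,u_k))$.\<close>

definition ext_deriv ::
  "('a, 'e::real_normed_vector) chart set \<Rightarrow> ('a, 'e) dform \<Rightarrow> ('a, 'e) dform"
  where
    "ext_deriv atlas \<alpha> = (\<lambda>x vs.
       if set vs \<subseteq> tangent_space atlas x then
         let c = chart_of atlas x; us = map (\<lambda>v. v c) vs in
           (\<Sum>i<length us. (-1) ^ i *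
              frechet_derivative (\<lambda>p. local_form atlas c \<alpha> p (take i us @ drop (Suc i) us))
                (at (cmap c x)) (us ! i))
       else 0)"

text \<open>The Lie derivative is given by
  $(L_X\alpha)(Y_1,\dots,Y_k) =
     X(\alpha(Y_1,\dots,Y_k)) - \sum_i \alpha(Y_1,\dots,[X,Y_i],\dots,Y_k)$.
  Here it is evaluated on the coordinate vector fields with constant components $u_i$ of a chart,
  in which $[X,u_i] = -\partial_{u_i}X$.\<close>

definition lie_deriv ::
  "('a, 'e::real_normed_vector) chart set \<Rightarrow> ('a \<Rightarrow> ('a, 'e) tvector) \<Rightarrow>
     ('a, 'e) dform \<Rightarrow> ('a, 'e) dform"
  where
    "lie_deriv atlas X \<alpha> = (\<lambda>x vs.
       if set vs \<subseteq> tangent_space atlas x then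
         let c = chart_of atlas x; us = map (\<lambda>v. v c) vs in
           frechet_derivative (\<lambda>p. local_form atlas c \<alpha> p us) (at (cmap c x)) (X x c)
           + (\<Sum>i<length us. local_form atlas c \<alpha> (cmap c x)
                (us[i := frechet_derivative (\<lambda>p. X (cinv c p) c) (at (cmap c x)) (us ! i)]))
       else 0)"


section \<open>Vector bundles and Lie algebroids\<close>

text \<open>A vector bundle is given by its fibres \<open>F x\<close>, which are subspaces of a vector space \<open>'v\<close>,
  and a set \<open>\<Phi>\<close> of local frames \<open>(U, ss)\<close>. A frame over \<open>U\<close> amounts to a local trivialisation
  over \<open>U\<close>; that the transition functions between any two of them are smooth is
  \<open>smooth_coefficients\<close> applied to the members of one frame and to the other frame.\<close>

type_synonym ('a, 'v) frame = "'a set \<times> ('a \<Rightarrow> 'v) list"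

definition pointwise_frame :: "('a \<Rightarrow> 'v::real_vector set) \<Rightarrow> 'a set \<Rightarrow> ('a \<Rightarrow> 'v) list \<Rightarrow> bool"
  where
    "pointwise_frame F U ss \<longleftrightarrow>
       (\<forall>x\<in>U. distinct (map (\<lambda>s. s x) ss) \<and>
          independent (set (map (\<lambda>s. s x) ss)) \<and> span (set (map (\<lambda>s. s x) ss)) = F x)"

definition smooth_coefficients ::
  "('a, 'e::real_normed_vector) chart set \<Rightarrow> 'a set \<Rightarrow> ('a \<Rightarrow> 'v::real_vector) list \<Rightarrow>
     ('a \<Rightarrow> 'v) \<Rightarrow> bool"
  where
    "smooth_coefficients atlas W ss s \<longleftrightarrow>
       (\<exists>g. (\<forall>i<length ss. smooth_fun_on atlas W (g i)) \<and>
            (\<forall>x\<in>W. s x = (\<Sum>i<length ss. g i x *\<^sub>R (ss ! i) x)))"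

definition vector_bundle ::
  "('a::topological_space, 'e::real_normed_vector) chart set \<Rightarrow> ('a \<Rightarrow> 'v::real_vector set) \<Rightarrow>
     ('a, 'v) frame set \<Rightarrow> bool"
  where
    "vector_bundle atlas F \<Phi> \<longleftrightarrow>
       (\<exists>r. \<forall>x. dim (F x) = r) \<and>
       (\<Union>(U, ss)\<in>\<Phi>. U) = UNIV \<and>
       (\<forall>(U, ss)\<in>\<Phi>. open U \<and> pointwise_frame F U ss) \<and>
       (\<forall>(U, ss)\<in>\<Phi>. \<forall>(V, ts)\<in>\<Phi>. \<forall>t\<in>set ts. smooth_coefficients atlas (U \<inter> V) ss t)"

definition smooth_sections ::
  "('a, 'e::real_normed_vector) chart set \<Rightarrow> ('a \<Rightarrow> 'v::real_vector set) \<Rightarrow>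
     ('a, 'v) frame set \<Rightarrow> ('a \<Rightarrow> 'v) set"
  where
    "smooth_sections atlas F \<Phi> =
       {s. (\<forall>x. s x \<in> F x) \<and> (\<forall>(U, ss)\<in>\<Phi>. smooth_coefficients atlas U ss s)}"

definition bundle_map_to_tangent ::
  "('a, 'e::real_normed_vector) chart set \<Rightarrow> ('a \<Rightarrow> 'v::real_vector set) \<Rightarrow>
     ('a, 'v) frame set \<Rightarrow> ('a \<Rightarrow> 'v \<Rightarrow> ('a, 'e) tvector) \<Rightarrow> bool"
  where
    "bundle_map_to_tangent atlas F \<Phi> \<rho> \<longleftrightarrow>
       (\<forall>x. \<forall>a\<in>F x. \<rho> x a \<in> tangent_space atlas x) \<and>
       (\<forall>x. \<forall>a\<in>F x. \<forall>b\<in>F x. \<forall>r s. \<rho> x (r *\<^sub>R a + s *\<^sub>R b) = r *\<^sub>R \<rho> x a + s *\<^sub>R \<rho> x b) \<and>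
       (\<forall>(U, ss)\<in>\<Phi>. \<forall>s\<in>set ss. smooth_vector_field_on atlas U (\<lambda>x. \<rho> x (s x)))"

text \<open>Compatibility of the anchor with the brackets is often part of the definition; it is a
  consequence of the remaining conditions.\<close>

definition lie_algebroid ::
  "('a::topological_space, 'e::real_normed_vector) chart set \<Rightarrow> ('a \<Rightarrow> 'v::real_vector set) \<Rightarrow>
     ('a, 'v) frame set \<Rightarrow> (('a \<Rightarrow> 'v) \<Rightarrow> ('a \<Rightarrow> 'v) \<Rightarrow> 'a \<Rightarrow> 'v) \<Rightarrow>
     ('a \<Rightarrow> 'v \<Rightarrow> ('a, 'e) tvector) \<Rightarrow> bool"
  where
    "lie_algebroid atlas F \<Phi> br \<rho> \<longleftrightarrow>
       vector_bundle atlas F \<Phi> \<and>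
       bundle_map_to_tangent atlas F \<Phi> \<rho> \<and>
       (let \<Gamma> = smooth_sections atlas F \<Phi> in
         (\<forall>\<alpha>\<in>\<Gamma>. \<forall>\<beta>\<in>\<Gamma>. br \<alpha> \<beta> \<in> \<Gamma>) \<and>
         (\<forall>\<alpha>\<in>\<Gamma>. \<forall>\<beta>\<in>\<Gamma>. \<forall>\<gamma>\<in>\<Gamma>. \<forall>r s.
            br (r *\<^sub>R \<alpha> + s *\<^sub>R \<beta>) \<gamma> = r *\<^sub>R br \<alpha> \<gamma> + s *\<^sub>R br \<beta> \<gamma> \<and>
            br \<gamma> (r *\<^sub>R \<alpha> + s *\<^sub>R \<beta>) = r *\<^sub>R br \<gamma> \<alpha> + s *\<^sub>R br \<gamma> \<beta>) \<and>
         (\<forall>\<alpha>\<in>\<Gamma>. br \<alpha> \<alpha> = 0) \<and>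
         (\<forall>\<alpha>\<in>\<Gamma>. \<forall>\<beta>\<in>\<Gamma>. \<forall>\<gamma>\<in>\<Gamma>.
            br \<alpha> (br \<beta> \<gamma>) + br \<beta> (br \<gamma> \<alpha>) + br \<gamma> (br \<alpha> \<beta>) = 0) \<and>
         (\<forall>\<alpha>\<in>\<Gamma>. \<forall>\<beta>\<in>\<Gamma>. \<forall>f. smooth_fun_on atlas UNIV f \<longrightarrow>
            br \<alpha> (\<lambda>x. f x *\<^sub>R \<beta> x) =
              (\<lambda>x. f x *\<^sub>R br \<alpha> \<beta> x + tangent_deriv atlas x (\<rho> x (\<alpha> x)) f *\<^sub>R \<beta> x)) \<and>
         (\<forall>\<alpha>\<in>\<Gamma>. \<forall>\<beta>\<in>\<Gamma>.
            (\<lambda>x. \<rho> x (br \<alpha> \<beta> x)) =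
              field_bracket atlas (\<lambda>x. \<rho> x (\<alpha> x)) (\<lambda>x. \<rho> x (\<beta> x))))"


section \<open>Multisymplectic manifolds\<close>

definition n_plectic ::
  "('a, 'e::real_normed_vector) chart set \<Rightarrow> nat \<Rightarrow> ('a, 'e) dform \<Rightarrow> bool"
  where
    "n_plectic atlas n \<omega> \<longleftrightarrow>
       smooth_form_on atlas (Suc n) UNIV \<omega> \<and>
       ext_deriv atlas \<omega> = 0 \<and>
       (\<forall>x. \<forall>v\<in>tangent_space atlas x. contract v (\<omega> x) = 0 \<longrightarrow> v = 0)"

definition admissible_fibre ::
  "('a, 'e::real_normed_vector) chart set \<Rightarrow> ('a, 'e) dform \<Rightarrow> 'a \<Rightarrow> ('a, 'e) covector set"
  where "admissible_fibre atlas \<omega> x = (\<lambda>v. contract v (\<omega> x)) ` tangent_space atlas x"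

text \<open>The bundle structure of the admissible bundle is the one of a subbundle of the bundle of
  \<open>n\<close>-forms: its local frames are the tuples of smooth local \<open>n\<close>-forms which form a basis of the
  admissible fibre at every point.\<close>

definition admissible_frames ::
  "('a::topological_space, 'e::real_normed_vector) chart set \<Rightarrow> nat \<Rightarrow> ('a, 'e) dform \<Rightarrow>
     ('a, ('a, 'e) covector) frame set"
  where
    "admissible_frames atlas n \<omega> =
       {(U, ss). open U \<and> (\<forall>s\<in>set ss. smooth_form_on atlas n U s) \<and>
          pointwise_frame (admissible_fibre atlas \<omega>) U ss}"

definition omega_sharp ::
  "('a, 'e::real_normed_vector) chart set \<Rightarrow> ('a, 'e) dform \<Rightarrow>
     'a \<Rightarrow> ('a, 'e) covector \<Rightarrow> ('a, 'e) tvector"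
  where
    "omega_sharp atlas \<omega> x a = (THE v. v \<in> tangent_space atlas x \<and> contract v (\<omega> x) = a)"

definition admissible_field ::
  "('a, 'e::real_normed_vector) chart set \<Rightarrow> ('a, 'e) dform \<Rightarrow>
     ('a, 'e) dform \<Rightarrow> 'a \<Rightarrow> ('a, 'e) tvector"
  where "admissible_field atlas \<omega> \<alpha> = (\<lambda>x. omega_sharp atlas \<omega> x (\<alpha> x))"

definition omega_bracket ::
  "('a, 'e::real_normed_vector) chart set \<Rightarrow> ('a, 'e) dform \<Rightarrow>
     ('a, 'e) dform \<Rightarrow> ('a, 'e) dform \<Rightarrow> ('a, 'e) dform"
  where
    "omega_bracket atlas \<omega> \<alpha> \<beta> =
       (let X = admissible_field atlas \<omega> \<alpha>; Y = admissible_field atlas \<omega> \<beta> in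
          lie_deriv atlas X \<beta> - lie_deriv atlas Y \<alpha>
          - ext_deriv atlas (interior_product X (interior_product Y \<omega>)))"

end

theory Submission
  imports Defs
begin

text \<open>If $\alpha = i_X\omega$ and $\beta = i_Y\omega$, then Cartan calculus and $d\omega = 0$ give
  $[\alpha,\beta]_\omega = i_{[X,Y]}\omega$. Since \<open>\<omega>\<close> is nondegenerate, $X \mapsto i_X\omega$ is an
  isomorphism from vector fields to sections of the admissible bundle, and it carries the bracket
  of vector fields to the bracket of the theorem. Everything thus reduces to the Lie algebroid
  structure of the tangent bundle. The inverse of $X \mapsto i_X\omega$ preserves smoothness because
  the solution of a linear system with smooth coefficients is smooth when it is unique.\<close>

section \<open>Smooth functions\<close>

text \<open>The Cartan computation: since d\<omega> = 0, L_X i_Y \<omega> = i_[X,Y] \<omega> + i_Y d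
  i_X \<omega> and L_Y i_X \<omega> = d i_Y i_X \<omega> + i_Y d i_X \<omega>; as i_Y i_X = - i_X
  i_Y, the last term of the bracket cancels what remains beside i_[X,Y] \<omega>. Because
  \<open>lie_deriv\<close> and \<open>ext_deriv\<close> at x are evaluated in the single chart
  \<open>chart_of atlas x\<close>, it is enough to differentiate coefficients in that chart. Of the
  differential operations, only the bracket of vector fields has to be compared between charts, and
  that rests on the symmetry of second derivatives. The obstacle is smoothness of the inverse. The
  admissible fibre is in general a proper subspace of the n-forms, so i_X \<omega> = \<alpha> is
  overdetermined, with one equation for each list of n vectors, and there is no square matrix to
  invert. Elimination needs only uniqueness of the solution. It is used again for coefficients in a
  frame, which links two descriptions of a smooth section: a smooth n-form with values in the fibre,
  and smooth coefficients in every frame.\<close>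

abbreviation fderiv :: "('a::real_normed_vector \<Rightarrow> 'b::real_normed_vector) \<Rightarrow> 'a \<Rightarrow> 'a \<Rightarrow> 'b"
  where "fderiv f p \<equiv> frechet_derivative f (at p)"

lemma fderiv_eq: "(f has_derivative f') (at p) \<Longrightarrow> fderiv f p = f'"
  by (metis frechet_derivative_at)

lemma fderiv_cong:
  assumes "f differentiable at p" "open S" "p \<in> S" "\<And>q. q \<in> S \<Longrightarrow> f q = g q"
  shows "fderiv f p = fderiv g p" "g differentiable at p"
proof -
  have "(g has_derivative fderiv f p) (at p)"
    using assms has_derivative_transform_within_open frechet_derivative_works by blast
  then show "fderiv f p = fderiv g p" "g differentiable at p"
    using fderiv_eq differentiable_def by metis+
qed

lemma higher_differentiable_on_cong:
  assumes "open S" "\<And>x. x \<in> S \<Longrightarrow> f x = g x" "higher_differentiable_on S f n"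
  shows "higher_differentiable_on S g n"
  using assms(2,3)
proof (induction n arbitrary: f g)
  case 0
  then show ?case using continuous_on_eq by auto
next
  case (Suc n)
  have "fderiv f x = fderiv g x \<and> g differentiable at x" if "x \<in> S" for x
    using Suc.prems that fderiv_cong[OF _ assms(1) that, of f g] by auto
  then show ?case
    using Suc.prems Suc.IH[of "\<lambda>x. fderiv f x v" "\<lambda>x. fderiv g x v" for v] by auto
qed

lemma higher_differentiable_on_SucD:
  "higher_differentiable_on S f (Suc n) \<Longrightarrow> higher_differentiable_on S f n"
proof (induction n arbitrary: f)
  case 0
  then show ?case
    by (auto intro!: continuous_at_imp_continuous_on differentiable_imp_continuous_within)
qed auto

text \<open>Smoothness can be tested near each point because the definition differentiates at points
  rather than relative to S. The elimination below depends on this: its pivot changes from point to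
  point.\<close>

lemma higher_differentiable_on_local:
  assumes "\<And>x. x \<in> S \<Longrightarrow> \<exists>T. open T \<and> x \<in> T \<and> higher_differentiable_on T f n"
  shows "higher_differentiable_on S f n"
  using assms
proof (induction n arbitrary: f)
  case 0
  show ?case
    unfolding higher_differentiable_on.simps
  proof (intro continuous_at_imp_continuous_on ballI)
    fix x assume "x \<in> S"
    from 0[OF this] show "isCont f x"
      using continuous_on_eq_continuous_at by auto
  qed
next
  case (Suc n)
  have "f differentiable at x" if "x \<in> S" for x
    using Suc.prems[OF that] by auto
  moreover have "higher_differentiable_on S (\<lambda>x. fderiv f x v) n" for v
  proof (rule Suc.IH)
    fix x assume "x \<in> S"
    from Suc.prems[OF this] show "\<exists>T. open T \<and> x \<in> T \<and> higher_differentiable_on T (\<lambda>x. fderiv f x v) n"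
      by auto
  qed
  ultimately show ?case by simp
qed

lemma higher_differentiable_on_const: "higher_differentiable_on S (\<lambda>x. k) n"
  by (induction n arbitrary: k) auto

lemma higher_differentiable_on_add:
  assumes "open S"
  shows "higher_differentiable_on S f n \<Longrightarrow> higher_differentiable_on S g n \<Longrightarrow>
    higher_differentiable_on S (\<lambda>x. f x + g x) n"
proof (induction n arbitrary: f g)
  case 0
  then show ?case by (auto intro: continuous_on_add)
next
  case (Suc n)
  have *: "fderiv (\<lambda>x. f x + g x) x = (\<lambda>v. fderiv f x v + fderiv g x v)" if "x \<in> S" for x
    using Suc.prems that
    by (intro fderiv_eq has_derivative_add) (auto simp: frechet_derivative_works)
  have "higher_differentiable_on S (\<lambda>x. fderiv (\<lambda>x. f x + g x) x v) n" for v
    by (rule higher_differentiable_on_cong[OF assms, of "\<lambda>x. fderiv f x v + fderiv g x v"])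
       (use Suc * in auto)
  then show ?case using Suc.prems by auto
qed

lemma higher_differentiable_on_scaleR:
  fixes f :: "'a::real_normed_vector \<Rightarrow> real"
  assumes "open S"
  shows "higher_differentiable_on S f n \<Longrightarrow> higher_differentiable_on S g n \<Longrightarrow>
    higher_differentiable_on S (\<lambda>x. f x *\<^sub>R g x) n"
proof (induction n arbitrary: f g)
  case 0
  then show ?case by (auto intro: continuous_on_scaleR)
next
  case (Suc n)
  have d: "((\<lambda>x. f x *\<^sub>R g x) has_derivative (\<lambda>v. f x *\<^sub>R fderiv g x v + fderiv f x v *\<^sub>R g x)) (at x)"
    if "x \<in> S" for x
    using Suc.prems that
    by (intro has_derivative_scaleR) (auto simp: frechet_derivative_works)
  have "higher_differentiable_on S (\<lambda>x. fderiv (\<lambda>x. f x *\<^sub>R g x) x v) n" for v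
  proof (rule higher_differentiable_on_cong[OF assms])
    show "higher_differentiable_on S (\<lambda>x. f x *\<^sub>R fderiv g x v + fderiv f x v *\<^sub>R g x) n"
      \<comment> \<open>Each summand pairs a derivative with an undifferentiated factor, which is
        known to order n + 1 and has to be lowered to order n.\<close>
      using Suc higher_differentiable_on_SucD[of S f n] higher_differentiable_on_SucD[of S g n]
      by (intro higher_differentiable_on_add[OF assms] Suc.IH) auto
  qed (use fderiv_eq[OF d] in auto)
  then show ?case using d by (auto simp: differentiable_def)
qed

lemma higher_differentiable_on_bounded_linear:
  assumes "open S" "bounded_linear L"
  shows "higher_differentiable_on S f n \<Longrightarrow> higher_differentiable_on S (\<lambda>x. L (f x)) n"
proof (induction n arbitrary: f)
  case 0
  then show ?case using bounded_linear.continuous_on[OF assms(2)] by auto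
next
  case (Suc n)
  have d: "((\<lambda>x. L (f x)) has_derivative (\<lambda>v. L (fderiv f x v))) (at x)" if "x \<in> S" for x
    using Suc.prems that
    by (intro bounded_linear.has_derivative[OF assms(2)]) (auto simp: frechet_derivative_works)
  have "higher_differentiable_on S (\<lambda>x. fderiv (\<lambda>x. L (f x)) x v) n" for v
    by (rule higher_differentiable_on_cong[OF assms(1), of "\<lambda>x. L (fderiv f x v)"])
       (use Suc fderiv_eq[OF d] in auto)
  then show ?case using d by (auto simp: differentiable_def)
qed

lemma higher_differentiable_on_sum:
  assumes "open S" "\<And>i. i \<in> I \<Longrightarrow> higher_differentiable_on S (f i) n"
  shows "higher_differentiable_on S (\<lambda>x. \<Sum>i\<in>I. f i x) n"
  using assms(2)
  by (induction I rule: infinite_finite_induct)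
     (auto intro: higher_differentiable_on_const higher_differentiable_on_add[OF assms(1)])

lemma higher_differentiable_on_inverse:
  fixes f :: "'a::real_normed_vector \<Rightarrow> real"
  assumes "open S" "\<And>x. x \<in> S \<Longrightarrow> f x \<noteq> 0"
  shows "higher_differentiable_on S f n \<Longrightarrow> higher_differentiable_on S (\<lambda>x. inverse (f x)) n"
proof (induction n)
  case 0
  then show ?case using assms by (auto intro: continuous_on_inverse)
next
  case (Suc n)
  have d: "((\<lambda>x. inverse (f x)) has_derivative
      (\<lambda>v. - (inverse (f x) * fderiv f x v * inverse (f x)))) (at x)" if "x \<in> S" for x
    using Suc.prems that assms
    by (intro Deriv.has_derivative_inverse) (auto simp: frechet_derivative_works)
  have "higher_differentiable_on S (\<lambda>x. fderiv (\<lambda>x. inverse (f x)) x v) n" for v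
  proof (rule higher_differentiable_on_cong[OF assms(1)])
    \<comment> \<open>The derivative of 1/f contains 1/f itself, to which the induction hypothesis
      applies, and a derivative of f. Nested scalings reduce it to the product rule.\<close>
    show "higher_differentiable_on S
        (\<lambda>x. - 1 *\<^sub>R inverse (f x) *\<^sub>R inverse (f x) *\<^sub>R fderiv f x v) n"
      using Suc higher_differentiable_on_SucD[of S f n]
      by (intro higher_differentiable_on_scaleR assms(1) higher_differentiable_on_const) auto
  qed (use fderiv_eq[OF d] in auto)
  then show ?case using d by (auto simp: differentiable_def)
qed

lemma smooth_on_cong:
  "open S \<Longrightarrow> smooth_on S f \<Longrightarrow> (\<And>x. x \<in> S \<Longrightarrow> f x = g x) \<Longrightarrow> smooth_on S g"
  unfolding smooth_on_def using higher_differentiable_on_cong by blast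

lemma smooth_on_local:
  assumes "\<And>x. x \<in> S \<Longrightarrow> \<exists>T. open T \<and> x \<in> T \<and> smooth_on T f"
  shows "smooth_on S f"
  unfolding smooth_on_def
proof (intro allI higher_differentiable_on_local)
  fix n x assume "x \<in> S"
  from assms[OF this] show "\<exists>T. open T \<and> x \<in> T \<and> higher_differentiable_on T f n"
    by (auto simp: smooth_on_def)
qed

lemma smooth_on_subset: "smooth_on S f \<Longrightarrow> open S \<Longrightarrow> T \<subseteq> S \<Longrightarrow> smooth_on T f"
  by (rule smooth_on_local) blast

lemma smooth_on_imp_differentiable: "smooth_on S f \<Longrightarrow> x \<in> S \<Longrightarrow> f differentiable at x"
  unfolding smooth_on_def by (metis higher_differentiable_on.simps(2))

lemma smooth_on_fderiv: "smooth_on S f \<Longrightarrow> smooth_on S (\<lambda>x. fderiv f x v)"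
  unfolding smooth_on_def by (metis higher_differentiable_on.simps(2))

lemma smooth_on_imp_continuous_on: "smooth_on S f \<Longrightarrow> continuous_on S f"
  unfolding smooth_on_def by (metis higher_differentiable_on.simps(1))

lemma smooth_on_const: "smooth_on S (\<lambda>x. k)"
  unfolding smooth_on_def using higher_differentiable_on_const by blast

lemma smooth_on_add:
  "open S \<Longrightarrow> smooth_on S f \<Longrightarrow> smooth_on S g \<Longrightarrow> smooth_on S (\<lambda>x. f x + g x)"
  unfolding smooth_on_def using higher_differentiable_on_add by blast

lemma smooth_on_scaleR:
  "open S \<Longrightarrow> smooth_on S f \<Longrightarrow> smooth_on S g \<Longrightarrow> smooth_on S (\<lambda>x. f x *\<^sub>R g x)"
  unfolding smooth_on_def using higher_differentiable_on_scaleR by blast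

lemma smooth_on_mult:
  fixes f :: "'a::real_normed_vector \<Rightarrow> real"
  shows "open S \<Longrightarrow> smooth_on S f \<Longrightarrow> smooth_on S g \<Longrightarrow> smooth_on S (\<lambda>x. f x * g x)"
  using smooth_on_scaleR[of S f g] by simp

lemma smooth_on_diff:
  assumes "open S" "smooth_on S f" "smooth_on S g"
  shows "smooth_on S (\<lambda>x. f x - g x)"
  using smooth_on_add[OF assms(1,2) smooth_on_scaleR[OF assms(1) smooth_on_const[of _ "-1"] assms(3)]]
  by simp

lemma smooth_on_sum:
  "open S \<Longrightarrow> (\<And>i. i \<in> I \<Longrightarrow> smooth_on S (f i)) \<Longrightarrow> smooth_on S (\<lambda>x. \<Sum>i\<in>I. f i x)"
  unfolding smooth_on_def by (intro allI higher_differentiable_on_sum) auto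

lemma smooth_on_divide:
  fixes f :: "'a::real_normed_vector \<Rightarrow> real"
  assumes "open S" "smooth_on S f" "smooth_on S g" "\<And>x. x \<in> S \<Longrightarrow> g x \<noteq> 0"
  shows "smooth_on S (\<lambda>x. f x / g x)"
  unfolding divide_inverse
  using assms higher_differentiable_on_inverse[OF assms(1,4)]
  by (intro smooth_on_mult) (auto simp: smooth_on_def)

lemma smooth_on_bounded_linear:
  "open S \<Longrightarrow> bounded_linear L \<Longrightarrow> smooth_on S f \<Longrightarrow> smooth_on S (\<lambda>x. L (f x))"
  unfolding smooth_on_def using higher_differentiable_on_bounded_linear by blast

text \<open>Gaussian elimination: the unknown indexed by the new element is removed near a point
  where one of its coefficients does not vanish.\<close>

lemma smooth_on_solve:
  fixes a :: "'i \<Rightarrow> 'j \<Rightarrow> 'e::real_normed_vector \<Rightarrow> real"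
  assumes "finite I" "open S"
    and "\<And>i j. i \<in> I \<Longrightarrow> j \<in> J \<Longrightarrow> smooth_on S (a i j)"
    and "\<And>j. j \<in> J \<Longrightarrow> smooth_on S (b j)"
    and "\<And>p j. p \<in> S \<Longrightarrow> j \<in> J \<Longrightarrow> b j p = (\<Sum>i\<in>I. g i p * a i j p)"
    and "\<And>p k i. p \<in> S \<Longrightarrow> (\<And>j. j \<in> J \<Longrightarrow> (\<Sum>i\<in>I. k i * a i j p) = 0) \<Longrightarrow> i \<in> I \<Longrightarrow> k i = 0"
    and "i \<in> I"
  shows "smooth_on S (g i)"
  using assms
proof (induction I arbitrary: S a b i rule: finite_induct)
  case empty
  then show ?case by simp
next
  case (insert l I)
  show ?case
  proof (rule smooth_on_local)
    fix x assume x: "x \<in> S"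
    \<comment> \<open>If all coefficients of the unknown l vanished at x, the unit vector at l would
      solve the homogeneous system there, against uniqueness.\<close>
    have "\<exists>j\<in>J. a l j x \<noteq> 0"
    proof (rule ccontr)
      assume "\<not> ?thesis"
      then have "(\<Sum>i\<in>insert l I. (if i = l then 1 else 0) * a i j x) = 0" if "j \<in> J" for j
        using that by (intro sum.neutral) auto
      from insert.prems(5)[OF x this, of l] show False by simp
    qed
    then obtain j where j: "j \<in> J" "a l j x \<noteq> 0" by blast
    \<comment> \<open>The pivot chosen at x stays nonzero on an open neighbourhood, so the divisions
      below are smooth there.\<close>
    define T where "T = {p \<in> S. a l j p \<noteq> 0}"
    have "open T"
      using continuous_open_preimage[OF smooth_on_imp_continuous_on[OF insert.prems(2)[of l j]]
          insert.prems(1), of "- {0}"] j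
      by (auto simp: T_def vimage_def Int_def open_delete)
    have sm: "smooth_on T f" if "smooth_on S f" for f :: "'e \<Rightarrow> real"
      using that insert.prems(1) by (rule smooth_on_subset) (auto simp: T_def)
    \<comment> \<open>Equation m minus the multiple of equation j that removes the unknown
      l.\<close>
    define a' where "a' i m p = a i m p - a i j p / a l j p * a l m p" for i m p
    define b' where "b' m p = b m p - b j p / a l j p * a l m p" for m p
    have eq: "b j p = g l p * a l j p + (\<Sum>i\<in>I. g i p * a i j p)" if "p \<in> T" "j \<in> J" for p j
      using insert.prems(4)[of p j] that insert.hyps by (auto simp: T_def)
    have IH: "smooth_on T (g i)" if "i \<in> I" for i
    proof (rule insert.IH[OF \<open>open T\<close> _ _ _ _ that, of a' b'])
      show "smooth_on T (a' i m)" if "i \<in> I" "m \<in> J" for i m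
        unfolding a'_def
        by (intro smooth_on_diff smooth_on_mult smooth_on_divide \<open>open T\<close> sm insert.prems)
           (use that j in \<open>auto simp: T_def\<close>)
      show "smooth_on T (b' m)" if "m \<in> J" for m
        unfolding b'_def
        by (intro smooth_on_diff smooth_on_mult smooth_on_divide \<open>open T\<close> sm insert.prems)
           (use that j in \<open>auto simp: T_def\<close>)
      show "b' m p = (\<Sum>i\<in>I. g i p * a' i m p)" if "p \<in> T" "m \<in> J" for p m
      proof -
        have nz: "a l j p \<noteq> 0" using that by (auto simp: T_def)
        have "(\<Sum>i\<in>I. g i p * a' i m p) =
            (\<Sum>i\<in>I. g i p * a i m p) - (\<Sum>i\<in>I. g i p * a i j p) * (a l m p / a l j p)"
          by (simp add: a'_def right_diff_distrib sum_subtractf sum_distrib_right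
            sum_divide_distrib mult.assoc)
        then show ?thesis
          unfolding b'_def eq[OF that(1) j(1)] eq[OF that] using nz
          by (simp add: add_divide_distrib distrib_right)
      qed
      show "k i = 0" if p: "p \<in> T" and z: "\<And>m. m \<in> J \<Longrightarrow> (\<Sum>i\<in>I. k i * a' i m p) = 0" and i: "i \<in> I"
        for p k i
      proof -
        \<comment> \<open>A homogeneous solution of the reduced system extends to one of the full
          system by solving equation j for the entry at l. Uniqueness thus passes to the reduced
          system.\<close>
        define k' where "k' i = (if i = l then - (\<Sum>i\<in>I. k i * a i j p) / a l j p else k i)" for i
        have "(\<Sum>i\<in>insert l I. k' i * a i m p) = 0" if "m \<in> J" for m
        proof -
          have "(\<Sum>i\<in>I. k' i * a i m p) = (\<Sum>i\<in>I. k i * a i m p)"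
            using insert.hyps by (intro sum.cong) (auto simp: k'_def)
          moreover have "(\<Sum>i\<in>I. k i * a i m p) =
              (\<Sum>i\<in>I. k i * a i j p) * (a l m p / a l j p)"
            using z[OF that]
            by (simp add: a'_def right_diff_distrib sum_subtractf sum_distrib_right
            sum_divide_distrib mult.assoc)
          ultimately show ?thesis using insert.hyps by (simp add: k'_def)
        qed
        then have "k' i = 0" using insert.prems(5)[of p k' i] p i by (auto simp: T_def)
        then show ?thesis using i insert.hyps by (auto simp: k'_def split: if_splits)
      qed
    qed
    \<comment> \<open>Back substitution: equation j expresses the eliminated unknown by the
      others.\<close>
    have "smooth_on T (\<lambda>p. (b j p - (\<Sum>i\<in>I. g i p * a i j p)) / a l j p)"
      by (intro smooth_on_divide smooth_on_diff smooth_on_sum smooth_on_mult IH \<open>open T\<close> sm insert.prems)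
         (use j in \<open>auto simp: T_def\<close>)
    then have "smooth_on T (g l)"
      by (rule smooth_on_cong[OF \<open>open T\<close>]) (use j eq[of _ j] in \<open>auto simp: T_def\<close>)
    then show "\<exists>T. open T \<and> x \<in> T \<and> smooth_on T (g i)"
      using IH \<open>open T\<close> x j insert.prems(6) by (auto simp: T_def)
  qed
qed

section \<open>Symmetry of second derivatives\<close>

lemma has_field_derivative_along_line:
  fixes f :: "'a::real_normed_vector \<Rightarrow> real"
  assumes "f differentiable at (a + s *\<^sub>R v)"
  shows "((\<lambda>s. f (a + s *\<^sub>R v)) has_field_derivative fderiv f (a + s *\<^sub>R v) v) (at s)"
proof -
  have "((\<lambda>s. f (a + s *\<^sub>R v)) has_derivative (\<lambda>h. fderiv f (a + s *\<^sub>R v) (h *\<^sub>R v))) (at s)"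
    by (rule has_derivative_compose[where f = "\<lambda>s. a + s *\<^sub>R v"])
       (use assms in \<open>auto intro!: derivative_eq_intros simp: frechet_derivative_works\<close>)
  moreover have "fderiv f (a + s *\<^sub>R v) (h *\<^sub>R v) = h * fderiv f (a + s *\<^sub>R v) v" for h
    using linear_frechet_derivative[OF assms] by (simp add: linear_scale)
  ultimately show ?thesis
    by (simp add: has_field_derivative_def mult_commute_abs)
qed

text \<open>The mean value theorem is used twice: along v for the increment of f in direction w, and
  along w for the derivative in direction v. Up to rearrangement the left side is symmetric in v and
  w, which makes it the means of comparing the two mixed derivatives.\<close>

lemma second_difference:
  fixes f :: "'a::real_normed_vector \<Rightarrow> real"
  assumes "smooth_on S f" "0 < e"
    and S: "\<And>s t. 0 \<le> s \<Longrightarrow> s \<le> e \<Longrightarrow> 0 \<le> t \<Longrightarrow> t \<le> e \<Longrightarrow> p + s *\<^sub>R v + t *\<^sub>R w \<in> S"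
  obtains s t where "0 \<le> s" "s \<le> e" "0 \<le> t" "t \<le> e"
    "f (p + e *\<^sub>R v + e *\<^sub>R w) - f (p + e *\<^sub>R v) - (f (p + e *\<^sub>R w) - f p) =
      e * e * fderiv (\<lambda>x. fderiv f x v) (p + s *\<^sub>R v + t *\<^sub>R w) w"
proof -
  define \<phi> where "\<phi> s = f (p + e *\<^sub>R w + s *\<^sub>R v) - f (p + s *\<^sub>R v)" for s
  have "(\<phi> has_field_derivative
      (fderiv f (p + e *\<^sub>R w + s *\<^sub>R v) v - fderiv f (p + s *\<^sub>R v) v)) (at s)"
    if "0 \<le> s" "s \<le> e" for s
    unfolding \<phi>_def
    using S[of s e] S[of s 0] that \<open>0 < e\<close>
    by (intro DERIV_diff has_field_derivative_along_line smooth_on_imp_differentiable[OF assms(1)])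
       (auto simp: algebra_simps)
  from MVT2[OF \<open>0 < e\<close> this] obtain s where s: "0 < s" "s < e"
    "\<phi> e - \<phi> 0 = e * (fderiv f (p + e *\<^sub>R w + s *\<^sub>R v) v - fderiv f (p + s *\<^sub>R v) v)"
    by auto
  have "((\<lambda>t. fderiv f (p + s *\<^sub>R v + t *\<^sub>R w) v) has_field_derivative
      fderiv (\<lambda>x. fderiv f x v) (p + s *\<^sub>R v + t *\<^sub>R w) w) (at t)" if "0 \<le> t" "t \<le> e" for t
    by (rule has_field_derivative_along_line[where f = "\<lambda>x. fderiv f x v"])
       (use S[of s t] that s in
         \<open>auto intro: smooth_on_imp_differentiable[OF smooth_on_fderiv[OF assms(1)]]\<close>)
  from MVT2[OF \<open>0 < e\<close> this] obtain t where t: "0 < t" "t < e"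
    "fderiv f (p + s *\<^sub>R v + e *\<^sub>R w) v - fderiv f (p + s *\<^sub>R v) v =
      e * fderiv (\<lambda>x. fderiv f x v) (p + s *\<^sub>R v + t *\<^sub>R w) w"
    by auto
  show thesis
    by (rule that[of s t]) (use s t in \<open>auto simp: \<phi>_def algebra_simps\<close>)
qed

text \<open>Both mixed derivatives, each at some point of a small parallelogram at p, equal the same
  second difference divided by \<open>e * e\<close>. By continuity a small enough parallelogram
  rules out a gap between their values at p.\<close>

lemma fderiv_commute_real:
  fixes f :: "'a::real_normed_vector \<Rightarrow> real"
  assumes "smooth_on S f" "open S" "p \<in> S"
  shows "fderiv (\<lambda>x. fderiv f x v) p w = fderiv (\<lambda>x. fderiv f x w) p v"
proof (rule ccontr)
  define F where "F v w q = fderiv (\<lambda>x. fderiv f x v) q w" for v w q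
  assume "\<not> ?thesis"
  then have ne: "dist (F v w p) (F w v p) > 0" by (simp add: F_def)
  define \<epsilon> where "\<epsilon> = dist (F v w p) (F w v p) / 2"
  have "\<epsilon> > 0" using ne by (simp add: \<epsilon>_def)
  have "isCont (F v w) p" for v w
    unfolding F_def
    using assms continuous_on_eq_continuous_at smooth_on_imp_continuous_on smooth_on_fderiv
    by metis
  then have *: "\<exists>d>0. \<forall>q. dist q p < d \<longrightarrow> dist (F v w q) (F v w p) < \<epsilon>" for v w
    unfolding continuous_at_eps_delta using \<open>\<epsilon> > 0\<close> by blast
  obtain d1 where d1: "d1 > 0" "\<And>q. dist q p < d1 \<Longrightarrow> dist (F v w q) (F v w p) < \<epsilon>"
    using * by blast
  obtain d2 where d2: "d2 > 0" "\<And>q. dist q p < d2 \<Longrightarrow> dist (F w v q) (F w v p) < \<epsilon>"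
    using * by blast
  obtain d3 where d3: "d3 > 0" "ball p d3 \<subseteq> S"
    using assms(2,3) openE by blast
  define d where "d = min d1 (min d2 d3)"
  \<comment> \<open>With this side length the parallelogram stays within d / 2 of p; the summand 1
    keeps the denominator positive when v and w vanish.\<close>
  define e where "e = d / (2 * (norm v + norm w + 1))"
  have pos: "norm v + norm w + 1 > 0"
    by (smt (verit) norm_ge_zero)
  have "d > 0" using d1 d2 d3 by (simp add: d_def)
  then have "e > 0" using pos by (simp add: e_def)
  have near: "dist (p + s *\<^sub>R v + t *\<^sub>R w) p < d" if "0 \<le> s" "s \<le> e" "0 \<le> t" "t \<le> e" for s t
  proof -
    have "norm (s *\<^sub>R v + t *\<^sub>R w) \<le> s * norm v + t * norm w"
      using that by (metis abs_of_nonneg norm_scaleR norm_triangle_ineq)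
    also have "\<dots> \<le> e * norm v + e * norm w"
      using that by (intro add_mono mult_right_mono) auto
    also have "\<dots> \<le> e * (norm v + norm w + 1)"
      using \<open>e > 0\<close> by (simp add: distrib_left)
    also have "\<dots> = d / 2"
    proof -
      have "d / (2 * N) * N = d / 2" if "N > 0" for N :: real using that by simp
      from this[OF pos] show ?thesis by (simp only: e_def)
    qed
    also have "\<dots> < d" using \<open>d > 0\<close> by simp
    finally show ?thesis by (simp add: dist_norm algebra_simps)
  qed
  have inS: "p + s *\<^sub>R v + t *\<^sub>R w \<in> S" if "0 \<le> s" "s \<le> e" "0 \<le> t" "t \<le> e" for s t
    using near[OF that] d3 by (auto simp: d_def dist_commute)
  obtain s t where st: "0 \<le> s" "s \<le> e" "0 \<le> t" "t \<le> e"
    "f (p + e *\<^sub>R v + e *\<^sub>R w) - f (p + e *\<^sub>R v) - (f (p + e *\<^sub>R w) - f p) =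
      e * e * F v w (p + s *\<^sub>R v + t *\<^sub>R w)"
    by (rule second_difference[OF assms(1) \<open>e > 0\<close> inS, folded F_def])
  have inS': "p + s *\<^sub>R w + t *\<^sub>R v \<in> S" if "0 \<le> s" "s \<le> e" "0 \<le> t" "t \<le> e" for s t
    using inS[of t s] that by (simp add: algebra_simps)
  obtain s' t' where st': "0 \<le> s'" "s' \<le> e" "0 \<le> t'" "t' \<le> e"
    "f (p + e *\<^sub>R w + e *\<^sub>R v) - f (p + e *\<^sub>R w) - (f (p + e *\<^sub>R v) - f p) =
      e * e * F w v (p + s' *\<^sub>R w + t' *\<^sub>R v)"
    by (rule second_difference[OF assms(1) \<open>e > 0\<close> inS', folded F_def])
  have swap: "p + t' *\<^sub>R v + s' *\<^sub>R w = p + s' *\<^sub>R w + t' *\<^sub>R v"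
    "p + e *\<^sub>R v + e *\<^sub>R w = p + e *\<^sub>R w + e *\<^sub>R v"
    by (simp_all add: algebra_simps)
  have "e * e * F v w (p + s *\<^sub>R v + t *\<^sub>R w) = e * e * F w v (p + s' *\<^sub>R w + t' *\<^sub>R v)"
    unfolding st(5)[symmetric] st'(5)[symmetric] swap by simp
  then have "F v w (p + s *\<^sub>R v + t *\<^sub>R w) = F w v (p + s' *\<^sub>R w + t' *\<^sub>R v)"
    using \<open>e > 0\<close> by simp
  moreover have "dist (F v w (p + s *\<^sub>R v + t *\<^sub>R w)) (F v w p) < \<epsilon>"
    using near[of s t] st d1 by (auto simp: d_def)
  moreover have "dist (F w v (p + s' *\<^sub>R w + t' *\<^sub>R v)) (F w v p) < \<epsilon>"
    using near[of t' s'] st' d2 by (auto simp: d_def swap)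
  ultimately show False
    \<comment> \<open>Both values at p would be closer to the common value than half their own
      distance, which is impossible.\<close>
    using dist_triangle_half_r[of "F v w (p + s *\<^sub>R v + t *\<^sub>R w)" "F v w p"
        "dist (F v w p) (F w v p)" "F w v p"]
    by (simp add: \<epsilon>_def)
qed

lemma fderiv_inner_right:
  assumes "f differentiable at x"
  shows "fderiv (\<lambda>x. f x \<bullet> k) x v = fderiv f x v \<bullet> k"
proof -
  have "((\<lambda>x. f x \<bullet> k) has_derivative (\<lambda>v. fderiv f x v \<bullet> k)) (at x)"
    using assms by (intro has_derivative_inner_left) (simp add: frechet_derivative_works)
  then show ?thesis by (simp add: fderiv_eq)
qed

text \<open>Pairing with an arbitrary vector k commutes with differentiation and reduces the claim
  to real-valued functions.\<close>

lemma fderiv_commute: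
  fixes f :: "'a::real_normed_vector \<Rightarrow> 'b::real_inner"
  assumes "smooth_on S f" "open S" "p \<in> S"
  shows "fderiv (\<lambda>x. fderiv f x v) p w = fderiv (\<lambda>x. fderiv f x w) p v"
proof -
  have *: "fderiv (\<lambda>x. fderiv f x v) p w \<bullet> k = fderiv (\<lambda>x. fderiv (\<lambda>x. f x \<bullet> k) x v) p w" for v w k
  proof -
    have "fderiv (\<lambda>x. fderiv f x v) p w \<bullet> k = fderiv (\<lambda>x. fderiv f x v \<bullet> k) p w"
      by (rule fderiv_inner_right[symmetric])
         (rule smooth_on_imp_differentiable[OF smooth_on_fderiv[OF assms(1)] assms(3)])
    also have "\<dots> = fderiv (\<lambda>x. fderiv (\<lambda>x. f x \<bullet> k) x v) p w"
    proof -
      have "(\<lambda>x. fderiv f x v \<bullet> k) differentiable at p"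
        by (rule smooth_on_imp_differentiable[OF smooth_on_bounded_linear[OF assms(2)
              bounded_linear_inner_left smooth_on_fderiv[OF assms(1)]] assms(3)])
      from fderiv_cong(1)[OF this assms(2,3)] show ?thesis
        using fderiv_inner_right smooth_on_imp_differentiable[OF assms(1)] by metis
    qed
    finally show ?thesis .
  qed
  have "smooth_on S (\<lambda>x. f x \<bullet> k)" for k
    by (rule smooth_on_bounded_linear[OF assms(2) bounded_linear_inner_left assms(1)])
  then have "fderiv (\<lambda>x. fderiv f x v) p w \<bullet> k = fderiv (\<lambda>x. fderiv f x w) p v \<bullet> k" for k
    unfolding * using fderiv_commute_real[OF _ assms(2,3)] by blast
  then have "(fderiv (\<lambda>x. fderiv f x v) p w - fderiv (\<lambda>x. fderiv f x w) p v) \<bullet> k = 0" for k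
    unfolding inner_diff_left right_minus_eq by blast
  then show ?thesis by (metis inner_eq_zero_iff right_minus_eq)
qed

section \<open>Orthonormal bases\<close>

text \<open>Takes the place of \<open>Basis\<close> for a model space that is only of class
  \<open>real_inner\<close>. In dimension 0 the set is empty.\<close>

definition orthonormal_basis :: "'e::real_inner set \<Rightarrow> bool"
  where "orthonormal_basis B \<longleftrightarrow> finite B \<and> span B = UNIV \<and>
    (\<forall>b\<in>B. \<forall>b'\<in>B. b \<bullet> b' = (if b = b' then 1 else 0))"

lemma orthonormal_basis_exists:
  fixes A :: "'e::real_inner set"
  assumes "finite A" "span A = UNIV"
  obtains B :: "'e set" where "orthonormal_basis B"
proof -
  obtain C where C: "finite C" "span C = (UNIV :: 'e set)" "pairwise orthogonal C"
    using basis_orthogonal[OF assms(1)] assms(2) by auto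
  \<comment> \<open>An orthogonal spanning set may contain 0, which cannot be normalised; dropping
    it leaves the span unchanged.\<close>
  define B where "B = (\<lambda>x. x /\<^sub>R norm x) ` (C - {0})"
  have "x \<in> span B" if "x \<in> C" for x
  proof (cases "x = 0")
    case False
    then have "x /\<^sub>R norm x \<in> span B"
      using that by (auto simp: B_def intro!: span_base)
    then have "norm x *\<^sub>R (x /\<^sub>R norm x) \<in> span B" by (rule span_scale)
    then show ?thesis using False by simp
  qed (simp add: span_zero)
  then have "span C \<subseteq> span B"
    by (intro span_minimal subspace_span) auto
  moreover have "b \<bullet> b' = (if b = b' then 1 else 0)" if B: "b \<in> B" "b' \<in> B" for b b'
  proof -
    obtain x y where x: "x \<in> C" "x \<noteq> 0" "b = x /\<^sub>R norm x"
      and y: "y \<in> C" "y \<noteq> 0" "b' = y /\<^sub>R norm y"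
      using B unfolding B_def by blast
    show ?thesis
    proof (cases "x = y")
      case True
      then show ?thesis using x y by (simp add: dot_square_norm power2_eq_square)
    next
      case False
      then have "x \<bullet> y = 0" using C(3) x y by (auto simp: pairwise_def orthogonal_def)
      then have "b \<bullet> b' = 0" using x y by simp
      moreover have "b \<bullet> b \<noteq> 0" using x by simp
      ultimately show ?thesis by auto
    qed
  qed
  ultimately show thesis
    using that[of B] C by (auto simp: orthonormal_basis_def B_def)
qed

lemma orthonormal_basis_finite: "orthonormal_basis B \<Longrightarrow> finite B"
  by (simp add: orthonormal_basis_def)

lemma orthonormal_basis_expand:
  assumes "orthonormal_basis B"
  shows "(\<Sum>b\<in>B. (u \<bullet> b) *\<^sub>R b) = u"
proof -
  have B: "finite B" "span B = UNIV" "\<forall>b\<in>B. \<forall>b'\<in>B. b \<bullet> b' = (if b = b' then 1 else 0)"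
    using assms by (auto simp: orthonormal_basis_def)
  have "u \<in> span B" using B by simp
  then show ?thesis
  proof (induction rule: span_induct)
    case base
    then show ?case
      by (auto simp: subspace_def inner_add_left scaleR_add_left sum.distrib
          scaleR_sum_right[symmetric] simp flip: scaleR_scaleR)
  next
    case (step x)
    then have "(\<Sum>b\<in>B. (x \<bullet> b) *\<^sub>R b) = (\<Sum>b\<in>B. if b = x then b else 0)"
      using B(3) by (intro sum.cong) auto
    then show ?case using step B(1) by simp
  qed
qed

lemma linear_expand:
  assumes "orthonormal_basis B" "linear f"
  shows "f u = (\<Sum>b\<in>B. (u \<bullet> b) *\<^sub>R f b)"
proof -
  have "f u = f (\<Sum>b\<in>B. (u \<bullet> b) *\<^sub>R b)"
    by (simp add: orthonormal_basis_expand[OF assms(1)])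
  then show ?thesis by (simp add: linear_sum[OF assms(2)] linear_scale[OF assms(2)])
qed

lemma orthonormal_basis_independent:
  assumes "orthonormal_basis B"
  shows "independent B"
proof (rule pairwise_orthogonal_independent)
  show "pairwise orthogonal B"
    using assms by (auto simp: pairwise_def orthogonal_def orthonormal_basis_def)
  show "0 \<notin> B" using assms by (force simp: orthonormal_basis_def)
qed

section \<open>Chain rule and smooth families of linear maps\<close>

lemma higher_differentiable_on_compose:
  fixes g :: "'d::real_normed_vector \<Rightarrow> 'e::real_inner" and B :: "'e set"
  assumes "orthonormal_basis B" "open S" "open T" "g ` S \<subseteq> T"
  shows "higher_differentiable_on T f n \<Longrightarrow> higher_differentiable_on S g n \<Longrightarrow>
    higher_differentiable_on S (\<lambda>x. f (g x)) n"
proof (induction n arbitrary: f)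
  case 0
  then show ?case using assms(4) continuous_on_compose2 by auto
next
  case (Suc n)
  have d: "((\<lambda>x. f (g x)) has_derivative (\<lambda>v. fderiv f (g x) (fderiv g x v))) (at x)"
    if "x \<in> S" for x
    by (rule has_derivative_compose[where f = g])
       (use Suc.prems that assms(4) in \<open>auto simp flip: frechet_derivative_works\<close>)
  \<comment> \<open>Expanding the moving direction \<open>fderiv g x v\<close> in the basis leaves
    derivatives of f in the fixed directions b, and to these the induction hypothesis
    applies.\<close>
  have e: "fderiv (\<lambda>x. f (g x)) x v = (\<Sum>b\<in>B. (fderiv g x v \<bullet> b) *\<^sub>R fderiv f (g x) b)"
    if "x \<in> S" for x v
  proof -
    have "linear (fderiv f (g x))"
      using Suc.prems that assms(4) by (intro linear_frechet_derivative) auto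
    from linear_expand[OF assms(1) this] show ?thesis unfolding fderiv_eq[OF d[OF that]] .
  qed
  have "higher_differentiable_on S (\<lambda>x. fderiv (\<lambda>x. f (g x)) x v) n" for v
  proof (rule higher_differentiable_on_cong[OF assms(2)])
    show "higher_differentiable_on S
        (\<lambda>x. \<Sum>b\<in>B. (fderiv g x v \<bullet> b) *\<^sub>R fderiv f (g x) b) n"
      by (intro higher_differentiable_on_sum higher_differentiable_on_scaleR assms(2) Suc.IH
          higher_differentiable_on_bounded_linear[OF assms(2) bounded_linear_inner_left])
         (use Suc.prems higher_differentiable_on_SucD in auto)
  qed (simp add: e)
  then show ?case using d by (auto simp: differentiable_def)
qed

lemma smooth_on_compose:
  fixes g :: "'d::real_normed_vector \<Rightarrow> 'e::real_inner" and B :: "'e set"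
  assumes "orthonormal_basis B" "open S" "open T" "g ` S \<subseteq> T" "smooth_on T f" "smooth_on S g"
  shows "smooth_on S (\<lambda>x. f (g x))"
  using higher_differentiable_on_compose[OF assms(1-4)] assms(5,6) by (auto simp: smooth_on_def)

text \<open>Product rule for a linear map and its argument that both depend on q. Differentiability
  of A is given for each fixed argument; the finite basis turns \<open>A q (g q)\<close> into a
  finite sum of scalars times such terms. Instances are \<open>fderiv f q (g q)\<close> and forms
  evaluated on vector fields.\<close>

lemma has_derivative_linear_family:
  fixes A :: "'d::real_normed_vector \<Rightarrow> 'e::real_inner \<Rightarrow> 'f::real_normed_vector" and B :: "'e set"
  assumes B: "orthonormal_basis B" and S: "open S" "p \<in> S"
    and lin: "\<And>q. q \<in> S \<Longrightarrow> linear (A q)"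
    and A: "\<And>u. (\<lambda>q. A q u) differentiable at p" and g: "g differentiable at p"
  shows "((\<lambda>q. A q (g q)) has_derivative
    (\<lambda>v. fderiv (\<lambda>q. A q (g p)) p v + A p (fderiv g p v))) (at p)"
proof -
  have dA: "((\<lambda>q. A q u) has_derivative fderiv (\<lambda>q. A q u) p) (at p)" for u
    using A by (simp add: frechet_derivative_works)
  have dg: "(g has_derivative fderiv g p) (at p)"
    using g by (simp add: frechet_derivative_works)
  have expand: "(\<Sum>b\<in>B. (u \<bullet> b) *\<^sub>R A q b) = A q u" if "q \<in> S" for q u
    by (rule linear_expand[OF B lin[OF that], symmetric])
  have "((\<lambda>q. \<Sum>b\<in>B. (g p \<bullet> b) *\<^sub>R A q b) has_derivative
      (\<lambda>v. \<Sum>b\<in>B. (g p \<bullet> b) *\<^sub>R fderiv (\<lambda>q. A q b) p v)) (at p)"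
    by (intro has_derivative_sum has_derivative_scaleR_right dA)
  then have "((\<lambda>q. A q (g p)) has_derivative
      (\<lambda>v. \<Sum>b\<in>B. (g p \<bullet> b) *\<^sub>R fderiv (\<lambda>q. A q b) p v)) (at p)"
    by (rule has_derivative_transform_within_open[OF _ S]) (rule expand)
  note 1 = fderiv_eq[OF this]
  have "((\<lambda>q. \<Sum>b\<in>B. (g q \<bullet> b) *\<^sub>R A q b) has_derivative
      (\<lambda>v. \<Sum>b\<in>B. (g p \<bullet> b) *\<^sub>R fderiv (\<lambda>q. A q b) p v + (fderiv g p v \<bullet> b) *\<^sub>R A p b)) (at p)"
    by (intro has_derivative_sum has_derivative_scaleR has_derivative_inner_left dA dg)
  then have "((\<lambda>q. A q (g q)) has_derivative
      (\<lambda>v. \<Sum>b\<in>B. (g p \<bullet> b) *\<^sub>R fderiv (\<lambda>q. A q b) p v + (fderiv g p v \<bullet> b) *\<^sub>R A p b)) (at p)"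
    by (rule has_derivative_transform_within_open[OF _ S]) (rule expand)
  then show ?thesis
    by (simp only: sum.distrib 1 expand[OF S(2)])
qed

lemma smooth_on_linear_family:
  fixes A :: "'d::real_normed_vector \<Rightarrow> 'e::real_inner \<Rightarrow> 'f::real_normed_vector" and B :: "'e set"
  assumes B: "orthonormal_basis B" and S: "open S"
    and lin: "\<And>q. q \<in> S \<Longrightarrow> linear (A q)"
    and A: "\<And>u. smooth_on S (\<lambda>q. A q u)" and g: "smooth_on S g"
  shows "smooth_on S (\<lambda>q. A q (g q))"
proof (rule smooth_on_cong[OF S])
  show "smooth_on S (\<lambda>q. \<Sum>b\<in>B. (g q \<bullet> b) *\<^sub>R A q b)"
    by (intro smooth_on_sum smooth_on_scaleR A
        smooth_on_bounded_linear[OF S bounded_linear_inner_left g] S)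
qed (metis linear_expand[OF B lin])


section \<open>The bracket of vector fields in coordinates\<close>

definition coord_bracket ::
  "('e::real_normed_vector \<Rightarrow> 'e) \<Rightarrow> ('e \<Rightarrow> 'e) \<Rightarrow> 'e \<Rightarrow> 'e"
  where "coord_bracket X Y p = fderiv Y p (X p) - fderiv X p (Y p)"

lemma linear_fderiv: "smooth_on S f \<Longrightarrow> p \<in> S \<Longrightarrow> linear (fderiv f p)"
  using linear_frechet_derivative smooth_on_imp_differentiable by blast

lemma has_derivative_fderiv_apply:
  fixes f :: "'e::real_inner \<Rightarrow> 'f::real_normed_vector" and B :: "'e set"
  assumes "orthonormal_basis B" "open S" "smooth_on S f" "smooth_on S g" "p \<in> S"
  shows "((\<lambda>q. fderiv f q (g q)) has_derivative
    (\<lambda>v. fderiv (\<lambda>q. fderiv f q (g p)) p v + fderiv f p (fderiv g p v))) (at p)"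
  by (rule has_derivative_linear_family[OF assms(1,2,5), where A = "fderiv f"])
     (use assms in \<open>auto intro: linear_fderiv smooth_on_imp_differentiable smooth_on_fderiv\<close>)

lemma smooth_on_fderiv_apply:
  fixes f :: "'e::real_inner \<Rightarrow> 'f::real_normed_vector" and B :: "'e set"
  assumes "orthonormal_basis B" "open S" "smooth_on S f" "smooth_on S g"
  shows "smooth_on S (\<lambda>q. fderiv f q (g q))"
  by (rule smooth_on_linear_family[OF assms(1,2), where A = "fderiv f"])
     (use assms in \<open>auto intro: linear_fderiv smooth_on_fderiv\<close>)

lemma smooth_on_coord_bracket:
  fixes X Y :: "'e::real_inner \<Rightarrow> 'e" and B :: "'e set"
  assumes "orthonormal_basis B" "open S" "smooth_on S X" "smooth_on S Y"
  shows "smooth_on S (coord_bracket X Y)"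
  unfolding coord_bracket_def[abs_def]
  by (intro smooth_on_diff smooth_on_fderiv_apply[OF assms(1)] assms)

text \<open>A double bracket consists of second derivatives and compositions of first derivatives.
  In the cyclic sum the former cancel in pairs by symmetry, the latter identically.\<close>

lemma coord_bracket_jacobi:
  fixes X Y Z :: "'e::real_inner \<Rightarrow> 'e" and B :: "'e set"
  assumes B: "orthonormal_basis B" and S: "open S" "p \<in> S"
    and sm: "smooth_on S X" "smooth_on S Y" "smooth_on S Z"
  shows "coord_bracket X (coord_bracket Y Z) p + coord_bracket Y (coord_bracket Z X) p +
    coord_bracket Z (coord_bracket X Y) p = 0"
proof -
  define h where "h X u v = fderiv (\<lambda>q. fderiv X q u) p v" for X :: "'e \<Rightarrow> 'e" and u v
  have h: "h X u v = h X v u" if "smooth_on S X" for X u v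
    unfolding h_def by (rule fderiv_commute[OF that S])
  have *: "coord_bracket X (coord_bracket Y Z) p =
      (h Z (Y p) (X p) + fderiv Z p (fderiv Y p (X p)))
      - (h Y (Z p) (X p) + fderiv Y p (fderiv Z p (X p)))
      - (fderiv X p (fderiv Z p (Y p)) - fderiv X p (fderiv Y p (Z p)))"
    if "smooth_on S X" "smooth_on S Y" "smooth_on S Z" for X Y Z :: "'e \<Rightarrow> 'e"
  proof -
    have "(coord_bracket Y Z has_derivative
      (\<lambda>v. (h Z (Y p) v + fderiv Z p (fderiv Y p v)) - (h Y (Z p) v + fderiv Y p (fderiv Z p v)))) (at p)"
      unfolding coord_bracket_def[abs_def] h_def
      by (intro has_derivative_diff has_derivative_fderiv_apply[OF B S(1)] that S)
    from fderiv_eq[OF this] show ?thesis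
      unfolding coord_bracket_def[of X]
      by (simp add: coord_bracket_def linear_diff[OF linear_fderiv[OF that(1) S(2)]])
  qed
  show ?thesis
    unfolding *[OF sm] *[OF sm(2,3,1)] *[OF sm(3,1,2)]
    using h[OF sm(1), of "Y p" "Z p"] h[OF sm(2), of "X p" "Z p"] h[OF sm(3), of "Y p" "X p"]
    by (simp add: algebra_simps)
qed

text \<open>Differentiating the relation between X' and X along Y yields, besides the expected
  terms, the second derivative of \<phi> on X and Y. It is symmetric and drops out of the
  difference. With a coordinate change as \<phi> this is the transformation law of the
  bracket.\<close>

lemma coord_bracket_related:
  fixes \<phi> X Y X' Y' :: "'e::real_inner \<Rightarrow> 'e" and B :: "'e set"
  assumes B: "orthonormal_basis B" and S: "open S" "p \<in> S"
    and sm: "smooth_on S \<phi>" "smooth_on S X" "smooth_on S Y"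
    and X': "X' differentiable at (\<phi> p)" "\<And>q. q \<in> S \<Longrightarrow> X' (\<phi> q) = fderiv \<phi> q (X q)"
    and Y': "Y' differentiable at (\<phi> p)" "\<And>q. q \<in> S \<Longrightarrow> Y' (\<phi> q) = fderiv \<phi> q (Y q)"
  shows "coord_bracket X' Y' (\<phi> p) = fderiv \<phi> p (coord_bracket X Y p)"
proof -
  have d\<phi>: "(\<phi> has_derivative fderiv \<phi> p) (at p)"
    using smooth_on_imp_differentiable[OF sm(1) S(2)] by (simp add: frechet_derivative_works)
  have *: "fderiv X' (\<phi> p) (fderiv \<phi> p v) =
      fderiv (\<lambda>q. fderiv \<phi> q (X p)) p v + fderiv \<phi> p (fderiv X p v)"
    if "smooth_on S X" "X' differentiable at (\<phi> p)" "\<And>q. q \<in> S \<Longrightarrow> X' (\<phi> q) = fderiv \<phi> q (X q)"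
    for X X' :: "'e \<Rightarrow> 'e" and v
  proof -
    have "((\<lambda>q. X' (\<phi> q)) has_derivative (\<lambda>v. fderiv X' (\<phi> p) (fderiv \<phi> p v))) (at p)"
      by (rule has_derivative_compose[OF d\<phi>]) (use that in \<open>simp add: frechet_derivative_works\<close>)
    moreover have "((\<lambda>q. X' (\<phi> q)) has_derivative
        (\<lambda>v. fderiv (\<lambda>q. fderiv \<phi> q (X p)) p v + fderiv \<phi> p (fderiv X p v))) (at p)"
      by (rule has_derivative_transform_within_open[OF
            has_derivative_fderiv_apply[OF B S(1) sm(1) that(1) S(2)] S])
         (use that in simp)
    ultimately show ?thesis by (rule fun_cong[OF has_derivative_unique])
  qed
  show ?thesis
    unfolding coord_bracket_def X'(2)[OF S(2)] Y'(2)[OF S(2)]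
      linear_diff[OF linear_fderiv[OF sm(1) S(2)]]
    using *[OF sm(2) X', of "Y p"] *[OF sm(3) Y', of "X p"]
      fderiv_commute[OF sm(1) S, of "X p" "Y p"] by simp
qed


section \<open>Alternating forms\<close>

lemma alternating_forms_support:
  "f \<in> alternating_forms k V \<Longrightarrow> \<not> (length vs = k \<and> set vs \<subseteq> V) \<Longrightarrow> f vs = 0"
  by (auto simp: alternating_forms_def)

lemma alternating_forms_linear:
  assumes "f \<in> alternating_forms k V" "Suc (length xs + length ys) = k"
    "set xs \<subseteq> V" "set ys \<subseteq> V" "u \<in> V" "v \<in> V"
  shows "f (xs @ (a *\<^sub>R u + b *\<^sub>R v) # ys) = a * f (xs @ u # ys) + b * f (xs @ v # ys)"
  using assms unfolding alternating_forms_def mem_Collect_eq by blast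

lemma alternating_forms_repeat:
  "f \<in> alternating_forms k V \<Longrightarrow> \<not> distinct vs \<Longrightarrow> f vs = 0"
  by (auto simp: alternating_forms_def)

lemma linear_alternating_form:
  assumes "f \<in> alternating_forms k UNIV"
  shows "linear (\<lambda>u. f (xs @ u # ys))"
proof (cases "Suc (length xs + length ys) = k")
  case True
  note L = alternating_forms_linear[OF assms True subset_UNIV subset_UNIV UNIV_I UNIV_I]
  show ?thesis
    by (rule linearI) (use L[where a = 1 and b = 1] L[where b = 0] in auto)
next
  case False
  then have "f (xs @ u # ys) = 0" for u
    using alternating_forms_support[OF assms] by auto
  then show ?thesis by (auto intro: linearI)
qed

lemma linear_alternating_form_hd:
  "f \<in> alternating_forms k UNIV \<Longrightarrow> linear (\<lambda>u. f (u # ys))"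
  using linear_alternating_form[of f k "[]"] by simp

text \<open>Polarisation: the form vanishes with u + v in two adjacent places, and with u or v in
  both.\<close>

lemma alternating_forms_swap:
  assumes "f \<in> alternating_forms k UNIV"
  shows "f (xs @ u # v # ys) = - f (xs @ v # u # ys)"
proof -
  have lin: "f (xs @ (u + v) # ys') = f (xs @ u # ys') + f (xs @ v # ys')" for ys'
    by (rule linear_add[OF linear_alternating_form[OF assms]])
  have lin': "f (xs @ w # (u + v) # ys) = f (xs @ w # u # ys) + f (xs @ w # v # ys)" for w
    using linear_add[OF linear_alternating_form[OF assms, of "xs @ [w]" ys]] by simp
  have "f (xs @ w # w # ys) = 0" for w
    by (rule alternating_forms_repeat[OF assms]) simp
  from this[of u] this[of v] this[of "u + v"] show ?thesis
    unfolding lin lin' by simp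
qed

lemma alternating_forms_move:
  assumes "f \<in> alternating_forms k UNIV"
  shows "f (xs @ u # zs @ ys) = (-1) ^ length zs * f (xs @ zs @ u # ys)"
proof (induction zs arbitrary: xs)
  case (Cons z zs)
  show ?case
    using alternating_forms_swap[OF assms, of xs u z "zs @ ys"] Cons.IH[of "xs @ [z]"] by simp
qed simp

text \<open>Translates between two kinds of terms: \<open>ext_deriv\<close> deletes entry i, and a
  vector depending on it turns up in front, while \<open>lie_deriv\<close> replaces entry i in
  place. The sign comes from moving past i entries.\<close>

lemma alternating_forms_update:
  assumes "f \<in> alternating_forms k UNIV" "i < length us"
  shows "f (xs @ u # take i us @ drop (Suc i) us) = (-1) ^ i * f (xs @ us[i := u])"
  using alternating_forms_move[OF assms(1), of xs u "take i us" "drop (Suc i) us"] assms(2)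
  by (simp add: upd_conv_take_nth_drop)

text \<open>Meant for \<open>coord_vector atlas c x\<close> as L, which turns a form on a tangent
  space into one on the whole model space.\<close>

lemma alternating_forms_pullback:
  fixes L :: "'u::real_vector \<Rightarrow> 'v::real_vector"
  assumes f: "f \<in> alternating_forms k V" and L: "linear L" "range L \<subseteq> V"
  shows "(\<lambda>us. f (map L us)) \<in> alternating_forms k UNIV"
  unfolding alternating_forms_def mem_Collect_eq
proof (intro conjI allI impI)
  fix us :: "'u list"
  show "f (map L us) = 0" if "\<not> (length us = k \<and> set us \<subseteq> UNIV)"
    by (rule alternating_forms_support[OF f]) (use that in simp)
  show "f (map L us) = 0" if "\<not> distinct us"
    by (rule alternating_forms_repeat[OF f]) (use that in \<open>auto simp: distinct_map\<close>)
next
  fix xs ys :: "'u list" and u v a b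
  assume "Suc (length xs + length ys) = k"
  then show "f (map L (xs @ (a *\<^sub>R u + b *\<^sub>R v) # ys)) =
      a * f (map L (xs @ u # ys)) + b * f (map L (xs @ v # ys))"
    using alternating_forms_linear[OF f, of "map L xs" "map L ys" "L u" "L v" a b] L(2)
    by (auto simp: linear_add[OF L(1)] linear_scale[OF L(1)])
qed

text \<open>The identity $L_X i_Y\omega - L_Y i_X\omega - d\,i_X i_Y\omega = i_{[X,Y]}\omega$ for closed
  \<open>\<omega>\<close>. The terms in which \<open>\<omega>\<close> is differentiated add up to $d\omega(X,Y,\dots)$.\<close>

lemma coord_cartan_bracket:
  fixes W :: "'e::real_inner \<Rightarrow> 'e list \<Rightarrow> real" and B :: "'e set"
  assumes B: "orthonormal_basis B" and S: "open S" "p \<in> S"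
    and alt: "\<And>q. q \<in> S \<Longrightarrow> W q \<in> alternating_forms k UNIV"
    and W: "\<And>us. (\<lambda>q. W q us) differentiable at p"
    and X: "X differentiable at p" and Y: "Y differentiable at p"
    and closed: "(\<Sum>i<length (X p # Y p # us). (-1) ^ i *
      fderiv (\<lambda>q. W q (take i (X p # Y p # us) @ drop (Suc i) (X p # Y p # us))) p
        ((X p # Y p # us) ! i)) = 0"
  shows "(fderiv (\<lambda>q. W q (Y q # us)) p (X p)
        + (\<Sum>i<length us. W p (Y p # us[i := fderiv X p (us ! i)])))
      - (fderiv (\<lambda>q. W q (X q # us)) p (Y p)
        + (\<Sum>i<length us. W p (X p # us[i := fderiv Y p (us ! i)])))
      - (\<Sum>i<length us. (-1) ^ i *
          fderiv (\<lambda>q. W q (Y q # X q # take i us @ drop (Suc i) us)) p (us ! i))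
    = W p (coord_bracket X Y p # us)"
proof -
  note altp = alt[OF S(2)]
  define r where "r i = take i us @ drop (Suc i) us" for i
  have D1: "((\<lambda>q. W q (Y q # us)) has_derivative
      (\<lambda>v. fderiv (\<lambda>q. W q (Y p # us)) p v + W p (fderiv Y p v # us))) (at p)"
    if "Y differentiable at p" for Y us
    by (rule has_derivative_linear_family[OF B S, where A = "\<lambda>q u. W q (u # us)"])
       (use W that in \<open>auto intro: linear_alternating_form_hd[OF alt]\<close>)
  have lin2: "linear (\<lambda>u. W q (Y q # u # us))" if "q \<in> S" for q us
    using linear_alternating_form[OF alt[OF that], of "[Y q]" us] by simp
  \<comment> \<open>i_X i_Y \<omega> has Y in the first place and X in the second. The product rule
    is applied once more, with the first place already variable.\<close>
  have D2: "((\<lambda>q. W q (Y q # X q # us)) has_derivative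
      (\<lambda>v. fderiv (\<lambda>q. W q (Y p # X p # us)) p v + W p (fderiv Y p v # X p # us)
        + W p (Y p # fderiv X p v # us))) (at p)" for us
  proof -
    have "(\<lambda>q. W q (Y q # u # us)) differentiable at p" for u
      using D1[OF Y] unfolding differentiable_def by blast
    from has_derivative_linear_family[OF B S, where A = "\<lambda>q u. W q (Y q # u # us)", OF lin2 this X]
    show ?thesis
      by (simp add: fderiv_eq[OF D1[OF Y]])
  qed
  \<comment> \<open>In d\<omega>(X, Y, ...) the terms along entries of us carry X before Y, opposite
    to the order in i_X i_Y \<omega>.\<close>
  have swapd: "fderiv (\<lambda>q. W q (X p # Y p # us)) p v = - fderiv (\<lambda>q. W q (Y p # X p # us)) p v"
    for us v
  proof -
    have "((\<lambda>q. - W q (Y p # X p # us)) has_derivative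
        (\<lambda>v. - fderiv (\<lambda>q. W q (Y p # X p # us)) p v)) (at p)"
      using W by (intro has_derivative_minus) (simp add: frechet_derivative_works)
    then have "((\<lambda>q. W q (X p # Y p # us)) has_derivative
        (\<lambda>v. - fderiv (\<lambda>q. W q (Y p # X p # us)) p v)) (at p)"
    proof (rule has_derivative_transform_within_open[OF _ S])
      fix q assume "q \<in> S"
      from alternating_forms_swap[OF alt[OF this], of "[]" "X p" "Y p" us]
      show "- W q (Y p # X p # us) = W q (X p # Y p # us)" by simp
    qed
    from fderiv_eq[OF this] show ?thesis by simp
  qed
  \<comment> \<open>The two leading summands of d\<omega> differentiate along X and Y; shifting the
    index by 2 preserves the signs of the others.\<close>
  have closed': "fderiv (\<lambda>q. W q (Y p # us)) p (X p) - fderiv (\<lambda>q. W q (X p # us)) p (Y p)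
      - (\<Sum>i<length us. (-1) ^ i * fderiv (\<lambda>q. W q (Y p # X p # r i)) p (us ! i)) = 0"
    using closed
    by (simp add: sum.lessThan_Suc_shift r_def swapd sum_negf del: sum.lessThan_Suc)
  \<comment> \<open>The terms of d i_X i_Y \<omega> that differentiate Y or X are matched with the
    sums in the two Lie derivatives, against which they cancel.\<close>
  have m1: "(-1) ^ i * W p (fderiv Y p (us ! i) # X p # r i) =
      - W p (X p # us[i := fderiv Y p (us ! i)])" if "i < length us" for i
    using alternating_forms_swap[OF altp, of "[]" "fderiv Y p (us ! i)" "X p" "r i"]
      alternating_forms_update[OF altp that, of "[X p]" "fderiv Y p (us ! i)"]
    by (simp add: r_def flip: power_mult_distrib mult.assoc)
  have m2: "(-1) ^ i * W p (Y p # fderiv X p (us ! i) # r i) =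
      W p (Y p # us[i := fderiv X p (us ! i)])" if "i < length us" for i
    using alternating_forms_update[OF altp that, of "[Y p]" "fderiv X p (us ! i)"]
    by (simp add: r_def flip: power_mult_distrib mult.assoc)
  have "(\<Sum>i<length us. (-1) ^ i * fderiv (\<lambda>q. W q (Y q # X q # r i)) p (us ! i)) =
      (\<Sum>i<length us. (-1) ^ i * fderiv (\<lambda>q. W q (Y p # X p # r i)) p (us ! i)
        - W p (X p # us[i := fderiv Y p (us ! i)]) + W p (Y p # us[i := fderiv X p (us ! i)]))"
    by (rule sum.cong) (simp_all add: fderiv_eq[OF D2] distrib_left m1 m2)
  moreover have "W p (coord_bracket X Y p # us) =
      W p (fderiv Y p (X p) # us) - W p (fderiv X p (Y p) # us)"
    unfolding coord_bracket_def by (rule linear_diff[OF linear_alternating_form_hd[OF altp]])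
  ultimately show ?thesis
    using closed' unfolding r_def[symmetric]
    by (simp add: fderiv_eq[OF D1[OF X]] fderiv_eq[OF D1[OF Y]] sum.distrib sum_subtractf)
qed


section \<open>Tangent vectors in coordinates\<close>

text \<open>One basis of the model space is fixed so that expansions in it are available throughout;
  \<open>orthonormal_basis_exists\<close> supplies it.\<close>

locale manifold_with_basis =
  fixes atlas :: "('a::{t2_space,second_countable_topology}, 'e::real_inner) chart set"
    and B :: "'e set"
  assumes manifold: "smooth_manifold atlas" and basis: "orthonormal_basis B"
begin

lemma open_cdom: "c \<in> atlas \<Longrightarrow> open (cdom c)"
  using manifold by (simp add: smooth_manifold_def)

lemma chart_homeomorphism:
  "c \<in> atlas \<Longrightarrow> homeomorphism (cdom c) (cmap c ` cdom c) (cmap c) (cinv c)"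
  using manifold by (simp add: smooth_manifold_def)

lemma cinv_cmap [simp]: "c \<in> atlas \<Longrightarrow> x \<in> cdom c \<Longrightarrow> cinv c (cmap c x) = x"
  using chart_homeomorphism homeomorphism_apply1 by blast

lemma open_cmap_image:
  assumes "c \<in> atlas" "open U"
  shows "open (cmap c ` (U \<inter> cdom c))"
proof -
  have "openin (top_of_set (cdom c)) (U \<inter> cdom c)"
    using assms(2) by (metis Int_commute openin_open_Int)
  then have "openin (top_of_set (cmap c ` cdom c)) (cmap c ` (U \<inter> cdom c))"
    by (rule homeomorphism_imp_open_map[OF chart_homeomorphism[OF assms(1)]])
  moreover have "open (cmap c ` cdom c)"
    using manifold assms(1) by (simp add: smooth_manifold_def)
  ultimately show ?thesis using openin_open_trans by blast
qed

lemma open_cmap_cdom: "c \<in> atlas \<Longrightarrow> open (cmap c ` cdom c)"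
  using open_cmap_image[of c UNIV] by simp

lemma chart_of_in: "chart_of atlas x \<in> charts_at atlas x"
proof -
  have "x \<in> (\<Union>c\<in>atlas. cdom c)" using manifold by (simp add: smooth_manifold_def)
  then have "\<exists>c. c \<in> charts_at atlas x" by (auto simp: charts_at_def)
  then show ?thesis unfolding chart_of_def by (rule someI_ex)
qed

lemma charts_atI: "c \<in> atlas \<Longrightarrow> x \<in> cdom c \<Longrightarrow> c \<in> charts_at atlas x"
  by (simp add: charts_at_def)

abbreviation transition :: "('a, 'e) chart \<Rightarrow> ('a, 'e) chart \<Rightarrow> 'a \<Rightarrow> 'e \<Rightarrow> 'e"
  where "transition c d x \<equiv> fderiv (cmap d \<circ> cinv c) (cmap c x)"

lemma smooth_on_coordinate_change:
  "c \<in> atlas \<Longrightarrow> d \<in> atlas \<Longrightarrow> smooth_on (cmap c ` (cdom c \<inter> cdom d)) (cmap d \<circ> cinv c)"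
  using manifold by (simp add: smooth_manifold_def)

lemma open_overlap: "c \<in> atlas \<Longrightarrow> d \<in> atlas \<Longrightarrow> open (cmap c ` (cdom c \<inter> cdom d))"
  using open_cmap_image[of c "cdom d"] open_cdom by (simp add: Int_commute)

lemma has_derivative_transition:
  assumes "c \<in> charts_at atlas x" "d \<in> charts_at atlas x"
  shows "((cmap d \<circ> cinv c) has_derivative transition c d x) (at (cmap c x))"
proof -
  have "cmap d \<circ> cinv c differentiable at (cmap c x)"
    by (rule smooth_on_imp_differentiable[OF smooth_on_coordinate_change])
       (use assms in \<open>auto simp: charts_at_def\<close>)
  then show ?thesis by (simp add: frechet_derivative_works)
qed

lemma linear_transition:
  "c \<in> charts_at atlas x \<Longrightarrow> d \<in> charts_at atlas x \<Longrightarrow> linear (transition c d x)"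
  by (rule has_derivative_linear[OF has_derivative_transition])

text \<open>The chain rule. This cocycle property is what makes \<open>coord_vector\<close> obey the
  transformation law of \<open>tangent_space\<close>.\<close>

lemma transition_trans:
  assumes "c \<in> charts_at atlas x" "d \<in> charts_at atlas x" "e \<in> charts_at atlas x"
  shows "transition c e x u = transition d e x (transition c d x u)"
proof -
  have c: "c \<in> atlas" "x \<in> cdom c" and d: "d \<in> atlas" "x \<in> cdom d"
    using assms by (auto simp: charts_at_def)
  have "((\<lambda>q. (cmap e \<circ> cinv d) ((cmap d \<circ> cinv c) q)) has_derivative
      (\<lambda>u. transition d e x (transition c d x u))) (at (cmap c x))"
  proof (rule has_derivative_compose[OF has_derivative_transition])
    show "((cmap e \<circ> cinv d) has_derivative transition d e x) (at ((cmap d \<circ> cinv c) (cmap c x)))"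
      using has_derivative_transition[OF assms(2,3)] by (simp only: o_apply cinv_cmap[OF c])
  qed (use assms in auto)
  then have "((cmap e \<circ> cinv c) has_derivative
      (\<lambda>u. transition d e x (transition c d x u))) (at (cmap c x))"
    by (rule has_derivative_transform_within_open[where s = "cmap c ` (cdom c \<inter> cdom d)"])
       (use c d open_overlap in auto)
  from fderiv_eq[OF this] show ?thesis by simp
qed

lemma transition_refl:
  assumes "c \<in> charts_at atlas x"
  shows "transition c c x u = u"
proof -
  have c: "c \<in> atlas" "x \<in> cdom c"
    using assms by (auto simp: charts_at_def)
  have "((\<lambda>q. q) has_derivative (\<lambda>u. u)) (at (cmap c x))"
    by (rule has_derivative_ident)
  then have "((cmap c \<circ> cinv c) has_derivative (\<lambda>u. u)) (at (cmap c x))"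
    by (rule has_derivative_transform_within_open[where s = "cmap c ` cdom c"])
       (use c open_cmap_cdom in auto)
  from fderiv_eq[OF this] show ?thesis by simp
qed

lemma coord_vector_apply:
  "d \<in> charts_at atlas x \<Longrightarrow> coord_vector atlas c x u d = transition c d x u"
  by (simp add: coord_vector_def)

lemma coord_vector_self [simp]:
  "c \<in> charts_at atlas x \<Longrightarrow> coord_vector atlas c x u c = u"
  by (simp add: coord_vector_apply transition_refl)

lemma coord_vector_in_tangent_space:
  assumes "c \<in> charts_at atlas x"
  shows "coord_vector atlas c x u \<in> tangent_space atlas x"
  unfolding tangent_space_def
proof (intro CollectI conjI ballI allI impI)
  show "coord_vector atlas c x u d = 0" if "d \<notin> charts_at atlas x" for d
    using that by (simp add: coord_vector_def)
  show "coord_vector atlas c x u e = transition d e x (coord_vector atlas c x u d)"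
    if "d \<in> charts_at atlas x" "e \<in> charts_at atlas x" for d e
    using that transition_trans[OF assms that] by (simp only: coord_vector_apply)
qed

lemma tangent_vector_change:
  "v \<in> tangent_space atlas x \<Longrightarrow> c \<in> charts_at atlas x \<Longrightarrow> d \<in> charts_at atlas x \<Longrightarrow>
    v d = transition c d x (v c)"
  unfolding tangent_space_def by blast

lemma tangent_vector_outside:
  "v \<in> tangent_space atlas x \<Longrightarrow> c \<notin> charts_at atlas x \<Longrightarrow> v c = 0"
  unfolding tangent_space_def by blast

lemma coord_vector_component:
  assumes "c \<in> charts_at atlas x" "v \<in> tangent_space atlas x"
  shows "coord_vector atlas c x (v c) = v"
proof
  fix d
  show "coord_vector atlas c x (v c) d = v d"
  proof (cases "d \<in> charts_at atlas x")
    case True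
    then show ?thesis
      using tangent_vector_change[OF assms(2,1) True] by (simp only: coord_vector_apply)
  next
    case False
    then show ?thesis using tangent_vector_outside[OF assms(2)] by (simp add: coord_vector_def)
  qed
qed

lemma tangent_vector_eqI:
  "u \<in> tangent_space atlas x \<Longrightarrow> v \<in> tangent_space atlas x \<Longrightarrow> c \<in> charts_at atlas x \<Longrightarrow>
    u c = v c \<Longrightarrow> u = v"
  by (metis coord_vector_component)

lemma linear_coord_vector:
  assumes "c \<in> charts_at atlas x"
  shows "linear (coord_vector atlas c x)"
proof (rule linearI)
  fix u v r
  show "coord_vector atlas c x (u + v) = coord_vector atlas c x u + coord_vector atlas c x v"
    using linear_add[OF linear_transition[OF assms]] by (auto simp: coord_vector_def)
  show "coord_vector atlas c x (r *\<^sub>R u) = r *\<^sub>R coord_vector atlas c x u"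
    using linear_scale[OF linear_transition[OF assms]]
    by (auto simp: coord_vector_def scaleR_fun_def)
qed

lemma tangent_space_range:
  assumes "c \<in> charts_at atlas x"
  shows "tangent_space atlas x = range (coord_vector atlas c x)"
  using coord_vector_in_tangent_space[OF assms] coord_vector_component[OF assms]
  by (auto intro: rangeI) (metis rangeI)

lemma subspace_tangent_space: "subspace (tangent_space atlas x)"
  using tangent_space_range[OF chart_of_in] linear_coord_vector[OF chart_of_in]
    linear_subspace_image[OF _ subspace_UNIV] by metis

section \<open>Vector fields\<close>

lemma smooth_vector_field_on_component:
  "smooth_vector_field_on atlas U X \<Longrightarrow> c \<in> atlas \<Longrightarrow>
    smooth_on (cmap c ` (U \<inter> cdom c)) (\<lambda>p. X (cinv c p) c)"
  by (simp add: smooth_vector_field_on_def)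

lemma smooth_vector_field_on_UNIV_component:
  "smooth_vector_field_on atlas UNIV X \<Longrightarrow> c \<in> atlas \<Longrightarrow>
    smooth_on (cmap c ` cdom c) (\<lambda>p. X (cinv c p) c)"
  using smooth_vector_field_on_component[of UNIV] by simp

lemma field_bracket_apply:
  "c \<in> charts_at atlas x \<Longrightarrow> field_bracket atlas X Y x c =
    coord_bracket (\<lambda>p. X (cinv c p) c) (\<lambda>p. Y (cinv c p) c) (cmap c x)"
  by (simp add: field_bracket_def coord_bracket_def charts_at_def)

text \<open>The components of a field in two charts are related by the coordinate change, so
  \<open>coord_bracket_related\<close> applies with \<open>cmap d \<circ> cinv c\<close> as
  \<phi>.\<close>

lemma field_bracket_in_tangent_space:
  assumes X: "smooth_vector_field_on atlas UNIV X" and Y: "smooth_vector_field_on atlas UNIV Y"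
  shows "field_bracket atlas X Y x \<in> tangent_space atlas x"
proof -
  have "field_bracket atlas X Y x d = transition c d x (field_bracket atlas X Y x c)"
    if cd: "c \<in> charts_at atlas x" "d \<in> charts_at atlas x" for c d
  proof -
    have c: "c \<in> atlas" "x \<in> cdom c" and d: "d \<in> atlas" "x \<in> cdom d"
      using cd by (auto simp: charts_at_def)
    let ?S = "cmap c ` (cdom c \<inter> cdom d)"
    have comp: "smooth_on ?S (\<lambda>p. Z (cinv c p) c)"
      "(\<lambda>p. Z (cinv d p) d) differentiable at ((cmap d \<circ> cinv c) (cmap c x))"
      "\<And>q. q \<in> ?S \<Longrightarrow>
        Z (cinv d ((cmap d \<circ> cinv c) q)) d = fderiv (cmap d \<circ> cinv c) q (Z (cinv c q) c)"
      if "smooth_vector_field_on atlas UNIV Z" for Z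
    proof -
      show "smooth_on ?S (\<lambda>p. Z (cinv c p) c)"
        by (rule smooth_on_subset[OF smooth_vector_field_on_UNIV_component[OF that c(1)]
              open_cmap_cdom[OF c(1)]]) auto
      show "(\<lambda>p. Z (cinv d p) d) differentiable at ((cmap d \<circ> cinv c) (cmap c x))"
        by (rule smooth_on_imp_differentiable[OF smooth_vector_field_on_UNIV_component[OF that d(1)]])
           (use c d in auto)
      fix q assume "q \<in> ?S"
      then obtain y where y: "q = cmap c y" "y \<in> cdom c" "y \<in> cdom d" by auto
      have "Z y \<in> tangent_space atlas y"
        using that by (simp add: smooth_vector_field_on_def)
      from tangent_vector_change[OF this charts_atI[OF c(1) y(2)] charts_atI[OF d(1) y(3)]]
      show "Z (cinv d ((cmap d \<circ> cinv c) q)) d =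
          fderiv (cmap d \<circ> cinv c) q (Z (cinv c q) c)"
        using y c d by simp
    qed
    have "coord_bracket (\<lambda>p. X (cinv d p) d) (\<lambda>p. Y (cinv d p) d) ((cmap d \<circ> cinv c) (cmap c x)) =
        transition c d x (coord_bracket (\<lambda>p. X (cinv c p) c) (\<lambda>p. Y (cinv c p) c) (cmap c x))"
      by (rule coord_bracket_related[OF basis open_overlap[OF c(1) d(1)] _
            smooth_on_coordinate_change[OF c(1) d(1)]])
         (use comp[OF X] comp[OF Y] c d in auto)
    then show ?thesis
      using c by (simp add: field_bracket_apply[OF cd(1)] field_bracket_apply[OF cd(2)])
  qed
  moreover have "field_bracket atlas X Y x c = 0" if "c \<notin> charts_at atlas x" for c
    using that by (simp add: field_bracket_def)
  ultimately show ?thesis unfolding tangent_space_def by blast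
qed

lemma field_bracket_component:
  assumes "c \<in> atlas" "p \<in> cmap c ` cdom c"
  shows "field_bracket atlas X Y (cinv c p) c =
    coord_bracket (\<lambda>p. X (cinv c p) c) (\<lambda>p. Y (cinv c p) c) p"
  using assms by (auto simp: field_bracket_apply charts_at_def)

lemma smooth_field_bracket:
  assumes X: "smooth_vector_field_on atlas UNIV X" and Y: "smooth_vector_field_on atlas UNIV Y"
  shows "smooth_vector_field_on atlas UNIV (field_bracket atlas X Y)"
  unfolding smooth_vector_field_on_def
proof (intro conjI ballI field_bracket_in_tangent_space[OF X Y])
  fix c assume c: "c \<in> atlas"
  have "smooth_on (cmap c ` cdom c) (coord_bracket (\<lambda>p. X (cinv c p) c) (\<lambda>p. Y (cinv c p) c))"
    by (intro smooth_on_coord_bracket[OF basis] open_cmap_cdom c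
        smooth_vector_field_on_UNIV_component X Y)
  then have "smooth_on (cmap c ` cdom c) (\<lambda>p. field_bracket atlas X Y (cinv c p) c)"
    by (rule smooth_on_cong[OF open_cmap_cdom[OF c]]) (simp add: field_bracket_component[OF c])
  then show "smooth_on (cmap c ` (UNIV \<inter> cdom c)) (\<lambda>p. field_bracket atlas X Y (cinv c p) c)"
    by simp
qed

lemma differentiable_component:
  assumes "smooth_vector_field_on atlas UNIV X" "c \<in> charts_at atlas x"
  shows "(\<lambda>p. X (cinv c p) c) differentiable at (cmap c x)"
  by (rule smooth_on_imp_differentiable[OF smooth_vector_field_on_UNIV_component[OF assms(1)]])
     (use assms(2) in \<open>auto simp: charts_at_def\<close>)

lemma has_derivative_component:
  assumes "smooth_vector_field_on atlas UNIV X" "c \<in> charts_at atlas x"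
  shows "((\<lambda>p. X (cinv c p) c) has_derivative fderiv (\<lambda>p. X (cinv c p) c) (cmap c x)) (at (cmap c x))"
  using differentiable_component[OF assms] by (simp add: frechet_derivative_works)

lemma field_bracket_jacobi:
  assumes X: "smooth_vector_field_on atlas UNIV X" and Y: "smooth_vector_field_on atlas UNIV Y"
    and Z: "smooth_vector_field_on atlas UNIV Z"
  shows "field_bracket atlas X (field_bracket atlas Y Z) x
    + field_bracket atlas Y (field_bracket atlas Z X) x
    + field_bracket atlas Z (field_bracket atlas X Y) x = 0"
proof (rule ext)
  fix c
  show "(field_bracket atlas X (field_bracket atlas Y Z) x
    + field_bracket atlas Y (field_bracket atlas Z X) x
    + field_bracket atlas Z (field_bracket atlas X Y) x) c = 0 c"
  proof (cases "c \<in> charts_at atlas x")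
    case True
    then have c: "c \<in> atlas" "x \<in> cdom c" by (auto simp: charts_at_def)
    note op = open_cmap_cdom[OF c(1)]
    have *: "field_bracket atlas X (field_bracket atlas Y Z) x c =
      coord_bracket (\<lambda>p. X (cinv c p) c)
        (coord_bracket (\<lambda>p. Y (cinv c p) c) (\<lambda>p. Z (cinv c p) c)) (cmap c x)"
      if "smooth_vector_field_on atlas UNIV Y" "smooth_vector_field_on atlas UNIV Z" for X Y Z
    proof -
      \<comment> \<open>The inner bracket is differentiated, so its coordinate formula is required
        around x and not only at x.\<close>
      have "fderiv (\<lambda>p. field_bracket atlas Y Z (cinv c p) c) (cmap c x) =
          fderiv (coord_bracket (\<lambda>p. Y (cinv c p) c) (\<lambda>p. Z (cinv c p) c)) (cmap c x)"
        by (rule fderiv_cong(1)[OF differentiable_component[OF smooth_field_bracket[OF that] True] op])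
           (use c field_bracket_component in auto)
      then show ?thesis
        unfolding field_bracket_apply[OF True] coord_bracket_def[of "\<lambda>p. X (cinv c p) c"]
        using c by (simp add: field_bracket_apply[OF True])
    qed
    show ?thesis
      using coord_bracket_jacobi[OF basis op _
          smooth_vector_field_on_UNIV_component[OF X c(1)]
          smooth_vector_field_on_UNIV_component[OF Y c(1)]
          smooth_vector_field_on_UNIV_component[OF Z c(1)], of "cmap c x"] c
      by (simp add: * X Y Z)
  qed (simp add: field_bracket_def)
qed

lemma smooth_vector_field_on_lincomb:
  assumes X: "smooth_vector_field_on atlas UNIV X" and Y: "smooth_vector_field_on atlas UNIV Y"
  shows "smooth_vector_field_on atlas UNIV (\<lambda>x. r *\<^sub>R X x + s *\<^sub>R Y x)"
  unfolding smooth_vector_field_on_def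
proof (intro conjI ballI)
  show "r *\<^sub>R X x + s *\<^sub>R Y x \<in> tangent_space atlas x" for x
    using X Y subspace_tangent_space
    by (auto simp: smooth_vector_field_on_def intro!: subspace_add subspace_scale)
  show "smooth_on (cmap c ` (UNIV \<inter> cdom c)) (\<lambda>p. (r *\<^sub>R X (cinv c p) + s *\<^sub>R Y (cinv c p)) c)"
    if c: "c \<in> atlas" for c
    unfolding plus_fun_apply scaleR_fun_def
    by (intro smooth_on_add smooth_on_scaleR smooth_on_const open_cmap_image
        smooth_vector_field_on_component open_UNIV c X Y)
qed

lemma field_bracket_lincomb_left:
  assumes X: "smooth_vector_field_on atlas UNIV X" and Y: "smooth_vector_field_on atlas UNIV Y"
    and Z: "smooth_vector_field_on atlas UNIV Z"
  shows "field_bracket atlas (\<lambda>x. r *\<^sub>R X x + s *\<^sub>R Y x) Z x =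
    r *\<^sub>R field_bracket atlas X Z x + s *\<^sub>R field_bracket atlas Y Z x"
proof
  fix c
  show "field_bracket atlas (\<lambda>x. r *\<^sub>R X x + s *\<^sub>R Y x) Z x c =
    (r *\<^sub>R field_bracket atlas X Z x + s *\<^sub>R field_bracket atlas Y Z x) c"
  proof (cases "c \<in> charts_at atlas x")
    case c: True
    let ?D = "\<lambda>X. fderiv (\<lambda>p. X (cinv c p) c) (cmap c x)"
    have "((\<lambda>p. r *\<^sub>R X (cinv c p) c + s *\<^sub>R Y (cinv c p) c) has_derivative
        (\<lambda>v. r *\<^sub>R ?D X v + s *\<^sub>R ?D Y v)) (at (cmap c x))"
      by (intro has_derivative_add has_derivative_scaleR_right has_derivative_component X Y c)
    from fderiv_eq[OF this]
    have "?D (\<lambda>x. r *\<^sub>R X x + s *\<^sub>R Y x) = (\<lambda>v. r *\<^sub>R ?D X v + s *\<^sub>R ?D Y v)"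
      by (simp add: scaleR_fun_def)
    moreover have "linear (?D Z)"
      using has_derivative_component[OF Z c] has_derivative_linear by blast
    ultimately show ?thesis
      using c by (simp add: field_bracket_def scaleR_fun_def linear_add linear_scale algebra_simps)
  qed (simp add: field_bracket_def scaleR_fun_def)
qed

lemma field_bracket_swap: "field_bracket atlas X Y x = - field_bracket atlas Y X x"
  by (auto simp: field_bracket_def)

lemma field_bracket_lincomb_right:
  assumes "smooth_vector_field_on atlas UNIV X" "smooth_vector_field_on atlas UNIV Y"
    "smooth_vector_field_on atlas UNIV Z"
  shows "field_bracket atlas Z (\<lambda>x. r *\<^sub>R X x + s *\<^sub>R Y x) x =
    r *\<^sub>R field_bracket atlas Z X x + s *\<^sub>R field_bracket atlas Z Y x"
  unfolding field_bracket_swap[of Z] field_bracket_lincomb_left[OF assms] by simp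

lemma smooth_vector_field_on_scale:
  assumes f: "smooth_fun_on atlas UNIV f" and X: "smooth_vector_field_on atlas UNIV X"
  shows "smooth_vector_field_on atlas UNIV (\<lambda>x. f x *\<^sub>R X x)"
  unfolding smooth_vector_field_on_def
proof (intro conjI ballI)
  show "f x *\<^sub>R X x \<in> tangent_space atlas x" for x
    using X subspace_tangent_space by (auto simp: smooth_vector_field_on_def intro!: subspace_scale)
  show "smooth_on (cmap c ` (UNIV \<inter> cdom c)) (\<lambda>p. (f (cinv c p) *\<^sub>R X (cinv c p)) c)"
    if c: "c \<in> atlas" for c
    unfolding scaleR_fun_def
    using f c
    by (intro smooth_on_scaleR open_cmap_image smooth_vector_field_on_component open_UNIV X)
       (auto simp: smooth_fun_on_def o_def)
qed

text \<open>Both sides are tangent vectors at x, so one chart decides. It is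
  \<open>chart_of atlas x\<close>, in which \<open>tangent_deriv\<close> is evaluated; there the
  claim is the product rule.\<close>

lemma field_bracket_leibniz:
  assumes f: "smooth_fun_on atlas UNIV f"
    and X: "smooth_vector_field_on atlas UNIV X" and Y: "smooth_vector_field_on atlas UNIV Y"
  shows "field_bracket atlas X (\<lambda>x. f x *\<^sub>R Y x) x =
    f x *\<^sub>R field_bracket atlas X Y x + tangent_deriv atlas x (X x) f *\<^sub>R Y x"
proof (rule tangent_vector_eqI[OF _ _ chart_of_in])
  define c where "c = chart_of atlas x"
  have cx: "c \<in> charts_at atlas x" by (simp add: c_def chart_of_in)
  then have c: "c \<in> atlas" "x \<in> cdom c" by (auto simp: charts_at_def)
  let ?D = "\<lambda>X. fderiv (\<lambda>p. X (cinv c p) c) (cmap c x)"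
  show "field_bracket atlas X (\<lambda>x. f x *\<^sub>R Y x) x \<in> tangent_space atlas x"
    by (intro field_bracket_in_tangent_space smooth_vector_field_on_scale f X Y)
  show "f x *\<^sub>R field_bracket atlas X Y x + tangent_deriv atlas x (X x) f *\<^sub>R Y x
      \<in> tangent_space atlas x"
    using field_bracket_in_tangent_space[OF X Y] Y subspace_tangent_space
    by (auto simp: smooth_vector_field_on_def intro!: subspace_add subspace_scale)
  have "(f \<circ> cinv c) differentiable at (cmap c x)"
    using f c by (auto simp: smooth_fun_on_def intro: smooth_on_imp_differentiable)
  then have df: "((f \<circ> cinv c) has_derivative fderiv (f \<circ> cinv c) (cmap c x)) (at (cmap c x))"
    by (simp only: frechet_derivative_works)
  have "((\<lambda>p. (f \<circ> cinv c) p *\<^sub>R Y (cinv c p) c) has_derivative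
      (\<lambda>v. (f \<circ> cinv c) (cmap c x) *\<^sub>R ?D Y v
        + fderiv (f \<circ> cinv c) (cmap c x) v *\<^sub>R Y (cinv c (cmap c x)) c)) (at (cmap c x))"
    by (rule has_derivative_scaleR[OF df has_derivative_component[OF Y cx]])
  from fderiv_eq[OF this]
  have "?D (\<lambda>x. f x *\<^sub>R Y x) =
      (\<lambda>v. f x *\<^sub>R ?D Y v + fderiv (f \<circ> cinv c) (cmap c x) v *\<^sub>R Y x c)"
    using c by (simp add: scaleR_fun_def)
  moreover have "linear (?D X)"
    using has_derivative_component[OF X cx] has_derivative_linear by blast
  ultimately show "field_bracket atlas X (\<lambda>x. f x *\<^sub>R Y x) x (chart_of atlas x) =
      (f x *\<^sub>R field_bracket atlas X Y x + tangent_deriv atlas x (X x) f *\<^sub>R Y x) (chart_of atlas x)"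
    unfolding c_def[symmetric] using cx
    by (simp add: field_bracket_def scaleR_fun_def linear_scale tangent_deriv_def Let_def
        algebra_simps flip: c_def)
qed

section \<open>Differential forms in coordinates\<close>

lemma alternating_local_form:
  assumes "\<alpha> x \<in> alternating_forms k (tangent_space atlas x)" "c \<in> charts_at atlas x"
  shows "local_form atlas c \<alpha> (cmap c x) \<in> alternating_forms k UNIV"
proof -
  have "local_form atlas c \<alpha> (cmap c x) = (\<lambda>us. \<alpha> x (map (coord_vector atlas c x) us))"
    using assms(2) by (auto simp: local_form_def charts_at_def)
  then show ?thesis
    using alternating_forms_pullback[OF assms(1) linear_coord_vector[OF assms(2)]]
      tangent_space_range[OF assms(2)] by simp
qed

lemma form_eq_local_form:
  assumes "c \<in> charts_at atlas x" "set vs \<subseteq> tangent_space atlas x"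
  shows "\<alpha> x vs = local_form atlas c \<alpha> (cmap c x) (map (\<lambda>v. v c) vs)"
proof -
  have "map (coord_vector atlas c x) (map (\<lambda>v. v c) vs) = vs"
    using assms coord_vector_component[OF assms(1)] by (auto intro!: map_idI)
  then show ?thesis using assms(1) by (simp add: local_form_def charts_at_def)
qed

lemma local_form_contract:
  assumes "c \<in> charts_at atlas x" "X x \<in> tangent_space atlas x"
  shows "local_form atlas c (interior_product X \<alpha>) (cmap c x) us =
    local_form atlas c \<alpha> (cmap c x) (X x c # us)"
  using assms coord_vector_component[OF assms]
  by (simp add: local_form_def interior_product_def contract_def charts_at_def)

end

text \<open>\<open>frechet_derivative\<close> is a choice among the derivatives at p, and f and g
  have the same ones, so the choices coincide even if there are none. This permits rewriting
  coefficients inside \<open>lie_deriv\<close> and \<open>ext_deriv\<close> directly.\<close>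

lemma fderiv_cong_open:
  assumes "open S" "p \<in> S" "\<And>q. q \<in> S \<Longrightarrow> f q = g q"
  shows "fderiv f p = fderiv g p"
proof -
  have "(f has_derivative f') (at p) \<longleftrightarrow> (g has_derivative f') (at p)" for f'
    using has_derivative_transform_within_open[OF _ assms(1,2)] assms(3) by metis
  then show ?thesis by (simp add: frechet_derivative_def)
qed

lemma contract_in_alternating_forms:
  assumes "f \<in> alternating_forms (Suc k) V" "v \<in> V"
  shows "contract v f \<in> alternating_forms k V"
  unfolding alternating_forms_def mem_Collect_eq contract_def
proof (intro conjI allI impI)
  show "f (v # vs) = 0" if "\<not> (length vs = k \<and> set vs \<subseteq> V)" for vs
    by (rule alternating_forms_support[OF assms(1)]) (use that in auto)
  show "f (v # vs) = 0" if "\<not> distinct vs" for vs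
    by (rule alternating_forms_repeat[OF assms(1)]) (use that in auto)
  show "f (v # xs @ (a *\<^sub>R u + b *\<^sub>R w) # ys) = a * f (v # xs @ u # ys) + b * f (v # xs @ w # ys)"
    if "Suc (length xs + length ys) = k" "set xs \<subseteq> V" "set ys \<subseteq> V" "u \<in> V" "w \<in> V" for xs ys u w a b
    using alternating_forms_linear[OF assms(1), of "v # xs" ys u w a b] that assms(2) by simp
qed

lemma contract_lincomb:
  assumes f: "f \<in> alternating_forms (Suc k) V" and V: "subspace V" "u \<in> V" "v \<in> V"
  shows "contract (r *\<^sub>R u + s *\<^sub>R v) f = r *\<^sub>R contract u f + s *\<^sub>R contract v f"
proof
  fix vs
  have w: "r *\<^sub>R u + s *\<^sub>R v \<in> V" using V by (simp add: subspace_add subspace_scale)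
  show "contract (r *\<^sub>R u + s *\<^sub>R v) f vs = (r *\<^sub>R contract u f + s *\<^sub>R contract v f) vs"
  proof (cases "length vs = k \<and> set vs \<subseteq> V")
    case True
    then show ?thesis
      using alternating_forms_linear[OF f, of "[]" vs u v r s] V
      by (simp add: contract_def scaleR_fun_def)
  next
    case False
    then have "contract w f vs = 0" if "w \<in> V" for w
      using alternating_forms_support[OF contract_in_alternating_forms[OF f that]] by blast
    then show ?thesis using w V by (simp add: scaleR_fun_def)
  qed
qed

text \<open>Frames are lists, while \<open>span\<close> and \<open>independent\<close> speak of
  sets; for distinct entries indexing is a bijection between the two views.\<close>

lemma span_list_obtain:
  assumes "distinct vs" "v \<in> span (set vs)"
  shows "\<exists>k. v = (\<Sum>i<length vs. k i *\<^sub>R vs ! i)"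
proof -
  obtain k where "v = (\<Sum>w\<in>set vs. k w *\<^sub>R w)"
    using assms(2) span_finite[of "set vs"] by auto
  also have "\<dots> = (\<Sum>i<length vs. k (vs ! i) *\<^sub>R vs ! i)"
    by (rule sum.reindex_bij_betw[OF bij_betw_nth[OF assms(1)], symmetric]) simp_all
  finally show ?thesis by (intro exI[of _ "\<lambda>i. k (vs ! i)"])
qed

lemma independent_listD:
  assumes "distinct vs" "independent (set vs)" "(\<Sum>i<length vs. k i *\<^sub>R vs ! i) = 0" "i < length vs"
  shows "k i = 0"
proof -
  have inj: "inj_on ((!) vs) {..<length vs}"
    using assms(1) by (simp add: inj_on_nth)
  define u where "u w = k (the_inv_into {..<length vs} ((!) vs) w)" for w
  have u: "u (vs ! i) = k i" if "i < length vs" for i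
    using the_inv_into_f_f[OF inj] that by (simp add: u_def)
  have "(\<Sum>w\<in>set vs. u w *\<^sub>R w) = (\<Sum>i<length vs. u (vs ! i) *\<^sub>R vs ! i)"
    by (rule sum.reindex_bij_betw[OF bij_betw_nth[OF assms(1)], symmetric]) simp_all
  also have "\<dots> = 0" using assms(3) u by simp
  finally have "u (vs ! i) = 0"
    using independentD[OF assms(2) _ subset_refl] assms(4) by auto
  then show ?thesis using u assms(4) by simp
qed

lemma sum_scaleR_fun_apply: "(\<Sum>i\<in>I. k i *\<^sub>R f i) x = (\<Sum>i\<in>I. k i *\<^sub>R f i x)"
  by (induction I rule: infinite_finite_induct) (auto simp: scaleR_fun_def)

context manifold_with_basis
begin

lemma smooth_form_on_subset:
  assumes "smooth_form_on atlas k U \<alpha>" "open U" "W \<subseteq> U"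
  shows "smooth_form_on atlas k W \<alpha>"
  unfolding smooth_form_on_def
proof (intro conjI ballI allI impI)
  show "\<alpha> x \<in> alternating_forms k (tangent_space atlas x)" if "x \<in> W" for x
    using assms that by (auto simp: smooth_form_on_def)
  show "smooth_on (cmap c ` (W \<inter> cdom c)) (\<lambda>p. local_form atlas c \<alpha> p us)"
    if "c \<in> atlas" "length us = k" for c us
    by (rule smooth_on_subset[OF _ open_cmap_image[OF that(1) assms(2)]])
       (use assms that in \<open>auto simp: smooth_form_on_def\<close>)
qed

lemma smooth_coord_vector:
  assumes c: "c \<in> atlas"
  shows "smooth_vector_field_on atlas (cdom c) (\<lambda>x. coord_vector atlas c x u)"
  unfolding smooth_vector_field_on_def
proof (intro conjI ballI)
  show "coord_vector atlas c x u \<in> tangent_space atlas x" if "x \<in> cdom c" for x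
    by (rule coord_vector_in_tangent_space[OF charts_atI[OF c that]])
  fix d assume d: "d \<in> atlas"
  have op: "open (cmap d ` (cdom c \<inter> cdom d))"
    using open_overlap[OF d c] by (simp add: Int_commute)
  have sm: "smooth_on (cmap d ` (cdom c \<inter> cdom d)) (cmap c \<circ> cinv d)"
    using smooth_on_coordinate_change[OF d c] by (simp add: Int_commute)
  \<comment> \<open>The derivative of the coordinate change from c to d is a function of the
    coordinates of c, but smoothness is tested in those of d; hence the composition with the inverse
    change.\<close>
  have "smooth_on (cmap d ` (cdom c \<inter> cdom d))
      (\<lambda>p. fderiv (cmap d \<circ> cinv c) ((cmap c \<circ> cinv d) p) u)"
    by (rule smooth_on_compose[OF basis op open_overlap[OF c d] _
          smooth_on_fderiv[OF smooth_on_coordinate_change[OF c d]] sm])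
       (use d in auto)
  then show "smooth_on (cmap d ` (cdom c \<inter> cdom d)) (\<lambda>p. coord_vector atlas c (cinv d p) u d)"
    by (rule smooth_on_cong[OF op]) (use c d in \<open>auto simp: coord_vector_def charts_at_def\<close>)
qed

end

section \<open>The pointwise isomorphism between tangent vectors and admissible covectors\<close>

locale n_plectic_manifold = manifold_with_basis atlas B
  for atlas :: "('a::{t2_space,second_countable_topology}, 'e::real_inner) chart set"
    and B :: "'e set" +
  fixes \<omega> :: "('a, 'e) dform" and n :: nat
  assumes n_plectic: "n_plectic atlas n \<omega>"
begin

abbreviation flat :: "('a \<Rightarrow> ('a, 'e) tvector) \<Rightarrow> ('a, 'e) dform"
  where "flat X \<equiv> interior_product X \<omega>"

abbreviation sharp :: "'a \<Rightarrow> ('a, 'e) covector \<Rightarrow> ('a, 'e) tvector"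
  where "sharp \<equiv> omega_sharp atlas \<omega>"

abbreviation fibre :: "'a \<Rightarrow> ('a, 'e) covector set"
  where "fibre \<equiv> admissible_fibre atlas \<omega>"

abbreviation is_field :: "('a \<Rightarrow> ('a, 'e) tvector) \<Rightarrow> bool"
  where "is_field X \<equiv> smooth_vector_field_on atlas UNIV X"

lemma alternating_omega: "\<omega> x \<in> alternating_forms (Suc n) (tangent_space atlas x)"
  using n_plectic by (simp add: n_plectic_def smooth_form_on_def)

lemma smooth_omega:
  "c \<in> atlas \<Longrightarrow> length us = Suc n \<Longrightarrow>
    smooth_on (cmap c ` cdom c) (\<lambda>p. local_form atlas c \<omega> p us)"
  using n_plectic by (simp add: n_plectic_def smooth_form_on_def)

lemma closed_omega: "ext_deriv atlas \<omega> x vs = 0"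
  using n_plectic by (simp add: n_plectic_def)

lemma nondegenerate: "v \<in> tangent_space atlas x \<Longrightarrow> contract v (\<omega> x) = 0 \<Longrightarrow> v = 0"
  using n_plectic by (simp add: n_plectic_def)

lemma alternating_local_omega:
  assumes "c \<in> atlas" "q \<in> cmap c ` cdom c"
  shows "local_form atlas c \<omega> q \<in> alternating_forms (Suc n) UNIV"
proof -
  obtain x where "q = cmap c x" "x \<in> cdom c" using assms(2) by auto
  then show ?thesis
    using alternating_local_form[of \<omega> x, OF alternating_omega charts_atI[OF assms(1)]] by simp
qed

lemmas contract_omega_lincomb = contract_lincomb[OF alternating_omega subspace_tangent_space]

lemmas contract_omega_alternating = contract_in_alternating_forms[OF alternating_omega]

lemma contract_omega_zero: "contract 0 (\<omega> x) = 0"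
  using contract_omega_lincomb[OF subspace_0 subspace_0, of x 0 0] subspace_tangent_space by simp

lemma inj_contract_omega:
  assumes "u \<in> tangent_space atlas x" "v \<in> tangent_space atlas x"
    "contract u (\<omega> x) = contract v (\<omega> x)"
  shows "u = v"
proof -
  have "u - v \<in> tangent_space atlas x"
    by (rule subspace_diff[OF subspace_tangent_space assms(1,2)])
  moreover have "contract (u - v) (\<omega> x) = 0"
    using contract_omega_lincomb[OF assms(1,2), of 1 "-1"] assms(3) by simp
  ultimately show ?thesis using nondegenerate by fastforce
qed

lemma sharp_contract:
  "v \<in> tangent_space atlas x \<Longrightarrow> sharp x (contract v (\<omega> x)) = v"
  unfolding omega_sharp_def using inj_contract_omega by blast

lemma sharp_in_tangent_space: "a \<in> fibre x \<Longrightarrow> sharp x a \<in> tangent_space atlas x"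
  by (auto simp: admissible_fibre_def sharp_contract)

lemma contract_sharp: "a \<in> fibre x \<Longrightarrow> contract (sharp x a) (\<omega> x) = a"
  by (auto simp: admissible_fibre_def sharp_contract)

lemma sharp_lincomb:
  assumes "a \<in> fibre x" "b \<in> fibre x"
  shows "sharp x (r *\<^sub>R a + s *\<^sub>R b) = r *\<^sub>R sharp x a + s *\<^sub>R sharp x b"
proof -
  obtain u v where u: "u \<in> tangent_space atlas x" "a = contract u (\<omega> x)"
    and v: "v \<in> tangent_space atlas x" "b = contract v (\<omega> x)"
    using assms by (auto simp: admissible_fibre_def)
  have "r *\<^sub>R u + s *\<^sub>R v \<in> tangent_space atlas x"
    using u v subspace_tangent_space by (simp add: subspace_add subspace_scale)
  then show ?thesis
    using u v by (simp add: sharp_contract flip: contract_omega_lincomb)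
qed


section \<open>The admissible bundle\<close>

abbreviation coord_covector :: "('a, 'e) chart \<Rightarrow> 'a \<Rightarrow> 'e \<Rightarrow> ('a, 'e) covector"
  where "coord_covector c x u \<equiv> contract (coord_vector atlas c x u) (\<omega> x)"

lemma linear_coord_covector:
  assumes "c \<in> charts_at atlas x"
  shows "linear (coord_covector c x)"
proof (rule linearI)
  note cv = coord_vector_in_tangent_space[OF assms]
  show "coord_covector c x (u + v) = coord_covector c x u + coord_covector c x v" for u v
    using contract_omega_lincomb[OF cv[of u] cv[of v], of 1 1]
    by (simp add: linear_add[OF linear_coord_vector[OF assms]])
  show "coord_covector c x (r *\<^sub>R u) = r *\<^sub>R coord_covector c x u" for r u
    using contract_omega_lincomb[OF cv[of u] cv[of u], of r 0]
    by (simp add: linear_scale[OF linear_coord_vector[OF assms]])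
qed

lemma inj_coord_covector:
  assumes "c \<in> charts_at atlas x"
  shows "inj (coord_covector c x)"
proof (rule injI)
  fix u v assume "coord_covector c x u = coord_covector c x v"
  then have "coord_vector atlas c x u = coord_vector atlas c x v"
    using inj_contract_omega coord_vector_in_tangent_space[OF assms] by blast
  then show "u = v" using coord_vector_self[OF assms] by metis
qed

lemma range_coord_covector:
  "c \<in> charts_at atlas x \<Longrightarrow> range (coord_covector c x) = fibre x"
  by (auto simp: admissible_fibre_def tangent_space_range)

text \<open>By nondegeneracy contraction is injective and carries a basis of the model space to one
  of the fibre. Its size is the same at all points, whence the constant rank.\<close>

lemma coord_covector_basis:
  assumes "c \<in> charts_at atlas x"
  shows "independent (coord_covector c x ` B)" "span (coord_covector c x ` B) = fibre x"
proof -
  show "independent (coord_covector c x ` B)"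
    by (rule linear_independent_injective_image[OF linear_coord_covector[OF assms]
          orthonormal_basis_independent[OF basis]])
       (use inj_coord_covector[OF assms] in \<open>auto intro: inj_on_subset\<close>)
  show "span (coord_covector c x ` B) = fibre x"
    using linear_span_image[OF linear_coord_covector[OF assms], of B]
      range_coord_covector[OF assms] basis
    by (simp add: orthonormal_basis_def)
qed

lemma dim_fibre: "dim (fibre x) = card B"
proof -
  note c = chart_of_in[of x]
  have "dim (fibre x) = card (coord_covector (chart_of atlas x) x ` B)"
    unfolding coord_covector_basis(2)[OF c, symmetric] dim_span
    by (rule dim_eq_card_independent[OF coord_covector_basis(1)[OF c]])
  then show ?thesis
    using card_image[OF inj_on_subset[OF inj_coord_covector[OF c] subset_UNIV]] by simp
qed

lemma smooth_flat:
  assumes "open U" "smooth_vector_field_on atlas U X"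
  shows "smooth_form_on atlas n U (flat X)"
  unfolding smooth_form_on_def
proof (intro conjI ballI allI impI)
  show "flat X x \<in> alternating_forms n (tangent_space atlas x)" if "x \<in> U" for x
    using contract_omega_alternating assms(2) that
    by (simp add: interior_product_def smooth_vector_field_on_def)
  fix c and us :: "'e list" assume c: "c \<in> atlas" and us: "length us = n"
  let ?S = "cmap c ` (U \<inter> cdom c)"
  have op: "open ?S" by (rule open_cmap_image[OF c assms(1)])
  have "smooth_on ?S (\<lambda>p. local_form atlas c \<omega> p (X (cinv c p) c # us))"
  proof (rule smooth_on_linear_family[OF basis op, where A = "\<lambda>p u. local_form atlas c \<omega> p (u # us)"])
    show "linear (\<lambda>u. local_form atlas c \<omega> p (u # us))" if "p \<in> ?S" for p
      by (rule linear_alternating_form_hd[OF alternating_local_omega[OF c]]) (use that in auto)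
    show "smooth_on ?S (\<lambda>p. local_form atlas c \<omega> p (u # us))" for u
      by (rule smooth_on_subset[OF smooth_omega[OF c] open_cmap_cdom[OF c]]) (use us in auto)
    show "smooth_on ?S (\<lambda>p. X (cinv c p) c)"
      by (rule smooth_vector_field_on_component[OF assms(2) c])
  qed
  then show "smooth_on ?S (\<lambda>p. local_form atlas c (flat X) p us)"
  proof (rule smooth_on_cong[OF op])
    fix p assume "p \<in> ?S"
    then obtain x where x: "p = cmap c x" "x \<in> U" "x \<in> cdom c" by auto
    then show "local_form atlas c \<omega> p (X (cinv c p) c # us) = local_form atlas c (flat X) p us"
      using local_form_contract[OF charts_atI[OF c], of x X \<omega> us] assms(2) c
      by (auto simp: smooth_vector_field_on_def)
  qed
qed

text \<open>In a chart the components of X with i_X \<omega> = s satisfy one linear equation for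
  each list us of n vectors, with smooth coefficients \<omega>(b, us) and right side s(us).
  Nondegeneracy makes the solution unique, so \<open>smooth_on_solve\<close> applies.\<close>

lemma smooth_sharp:
  assumes U: "open U" and s: "smooth_form_on atlas n U s" and sF: "\<And>x. x \<in> U \<Longrightarrow> s x \<in> fibre x"
  shows "smooth_vector_field_on atlas U (\<lambda>x. sharp x (s x))"
  unfolding smooth_vector_field_on_def
proof (intro conjI ballI)
  show T: "sharp x (s x) \<in> tangent_space atlas x" if "x \<in> U" for x
    by (rule sharp_in_tangent_space[OF sF[OF that]])
  fix c assume c: "c \<in> atlas"
  let ?S = "cmap c ` (U \<inter> cdom c)"
  let ?X = "\<lambda>p. sharp (cinv c p) (s (cinv c p)) c"
  have op: "open ?S" by (rule open_cmap_image[OF c U])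
  have lin: "linear (\<lambda>u. local_form atlas c \<omega> p (u # us))" if "p \<in> ?S" for p us
    by (rule linear_alternating_form_hd[OF alternating_local_omega[OF c]]) (use that in auto)
  have X: "smooth_on ?S (\<lambda>p. ?X p \<bullet> b)" if "b \<in> B" for b
  proof (rule smooth_on_solve[where I = B and J = "{us. length us = n}" and i = b
        and a = "\<lambda>b us p. local_form atlas c \<omega> p (b # us)" and b = "\<lambda>us p. local_form atlas c s p us"
        and g = "\<lambda>b p. ?X p \<bullet> b"])
    show "finite B" by (rule orthonormal_basis_finite[OF basis])
    show "smooth_on ?S (\<lambda>p. local_form atlas c \<omega> p (b # us))" if "us \<in> {us. length us = n}" for b us
      by (rule smooth_on_subset[OF smooth_omega[OF c] open_cmap_cdom[OF c]]) (use that in auto)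
    show "smooth_on ?S (\<lambda>p. local_form atlas c s p us)" if "us \<in> {us. length us = n}" for us
      using s c that by (simp add: smooth_form_on_def)
    show "local_form atlas c s p us = (\<Sum>b\<in>B. (?X p \<bullet> b) * local_form atlas c \<omega> p (b # us))"
      if p: "p \<in> ?S" for p us
    proof -
      obtain x where x: "p = cmap c x" "x \<in> U" "x \<in> cdom c" using p by auto
      have "local_form atlas c s p us = local_form atlas c (flat (\<lambda>x. sharp x (s x))) p us"
        using x c contract_sharp[OF sF] by (simp add: local_form_def interior_product_def)
      also have "\<dots> = local_form atlas c \<omega> p (?X p # us)"
        using local_form_contract[OF charts_atI[OF c], of x "\<lambda>x. sharp x (s x)"] x c T by simp
      also have "\<dots> = (\<Sum>b\<in>B. (?X p \<bullet> b) * local_form atlas c \<omega> p (b # us))"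
        using linear_expand[OF basis lin[OF p], where u = "?X p"] by (simp only: real_scaleR_def)
      finally show ?thesis .
    qed
    show "k b = 0" if p: "p \<in> ?S" and b: "b \<in> B"
      and k: "\<And>us. us \<in> {us. length us = n} \<Longrightarrow> (\<Sum>b\<in>B. k b * local_form atlas c \<omega> p (b # us)) = 0"
      for p k b
    proof -
      obtain x where x: "p = cmap c x" "x \<in> U" "x \<in> cdom c" using p by auto
      have cx: "c \<in> charts_at atlas x" by (rule charts_atI[OF c x(3)])
      \<comment> \<open>A homogeneous solution k consists of the components of a vector u in the
        kernel of the contraction.\<close>
      define u where "u = (\<Sum>b\<in>B. k b *\<^sub>R b)"
      have z: "local_form atlas c \<omega> p (u # us) = 0" if "length us = n" for us
        using k[of us] that
        by (simp add: u_def linear_sum[OF lin[OF p]] linear_scale[OF lin[OF p]])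
      \<comment> \<open>Lists of n tangent vectors reduce to coordinates; on all others a form is 0
        by convention, so the contraction is 0 as a function.\<close>
      have "contract (coord_vector atlas c x u) (\<omega> x) vs = 0" for vs
      proof (cases "length vs = n \<and> set vs \<subseteq> tangent_space atlas x")
        case True
        then have "\<omega> x (coord_vector atlas c x u # vs) =
            local_form atlas c \<omega> p (u # map (\<lambda>v. v c) vs)"
          using form_eq_local_form[OF cx, of "coord_vector atlas c x u # vs" \<omega>]
            coord_vector_in_tangent_space[OF cx] coord_vector_self[OF cx] x by simp
        then show ?thesis using z True by (simp add: contract_def)
      next
        case False
        then show ?thesis
          using alternating_forms_support[OF contract_omega_alternating[OF
                coord_vector_in_tangent_space[OF cx]]] by blast
      qed
      then have "contract (coord_vector atlas c x u) (\<omega> x) = 0" by (simp add: fun_eq_iff)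
      then have "coord_vector atlas c x u = 0"
        using nondegenerate coord_vector_in_tangent_space[OF cx] by blast
      then have "u = 0" using coord_vector_self[OF cx, of u] by simp
      then show "k b = 0"
        using independentD[OF orthonormal_basis_independent[OF basis]
            orthonormal_basis_finite[OF basis] subset_refl _ b] by (simp add: u_def)
    qed
  qed (use op that in auto)
  show "smooth_on ?S ?X"
  proof (rule smooth_on_cong[OF op])
    show "smooth_on ?S (\<lambda>p. \<Sum>b\<in>B. (?X p \<bullet> b) *\<^sub>R b)"
      by (intro smooth_on_sum smooth_on_scaleR smooth_on_const X op)
  qed (simp add: orthonormal_basis_expand[OF basis])
qed

lemma admissible_framesD:
  assumes "(U, ss) \<in> admissible_frames atlas n \<omega>"
  shows "open U" "s \<in> set ss \<Longrightarrow> smooth_form_on atlas n U s" "pointwise_frame fibre U ss"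
  using assms by (auto simp: admissible_frames_def)

lemma frame_in_fibre:
  assumes "(U, ss) \<in> admissible_frames atlas n \<omega>" "s \<in> set ss" "x \<in> U"
  shows "s x \<in> fibre x"
proof -
  have "s x \<in> span (set (map (\<lambda>s. s x) ss))" using assms(2) by (auto intro: span_base)
  then show ?thesis using admissible_framesD(3)[OF assms(1)] assms(3) by (simp add: pointwise_frame_def)
qed

text \<open>The same elimination with the coefficients in the frame as unknowns; linear independence
  at each point is the uniqueness.\<close>

lemma smooth_coefficients_frame:
  assumes fr: "(U, ss) \<in> admissible_frames atlas n \<omega>" and W: "open W" "W \<subseteq> U"
    and s: "smooth_form_on atlas n W s" and sF: "\<And>x. x \<in> W \<Longrightarrow> s x \<in> fibre x"
  shows "smooth_coefficients atlas W ss s"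
proof -
  note ssD = admissible_framesD[OF fr]
  have pf: "distinct (map (\<lambda>s. s x) ss)" "independent (set (map (\<lambda>s. s x) ss))"
    "span (set (map (\<lambda>s. s x) ss)) = fibre x" if "x \<in> W" for x
    using ssD(3) that W(2) by (auto simp: pointwise_frame_def)
  have "\<exists>k. s x = (\<Sum>i<length ss. k i *\<^sub>R (ss ! i) x)" if x: "x \<in> W" for x
  proof -
    have "s x \<in> span (set (map (\<lambda>s. s x) ss))"
      unfolding pf(3)[OF x] by (rule sF[OF x])
    then obtain k where "s x = (\<Sum>i<length (map (\<lambda>s. s x) ss). k i *\<^sub>R map (\<lambda>s. s x) ss ! i)"
      using span_list_obtain[OF pf(1)[OF x]] by blast
    also have "\<dots> = (\<Sum>i<length ss. k i *\<^sub>R (ss ! i) x)"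
      by (rule sum.cong) auto
    finally show ?thesis by blast
  qed
  \<comment> \<open>The coefficients are merely chosen point by point; as the only solution they are
    nevertheless smooth.\<close>
  then have "\<exists>k. \<forall>x\<in>W. s x = (\<Sum>i<length ss. k x i *\<^sub>R (ss ! i) x)"
    by (intro bchoice ballI)
  then obtain k where k: "\<And>x. x \<in> W \<Longrightarrow> s x = (\<Sum>i<length ss. k x i *\<^sub>R (ss ! i) x)"
    by blast
  have "smooth_on (cmap c ` (W \<inter> cdom c)) ((\<lambda>x. k x i) \<circ> cinv c)"
    if c: "c \<in> atlas" and i: "i < length ss" for c i
  proof (rule smooth_on_solve[where I = "{..<length ss}" and J = "{us. length us = n}" and i = i
        and a = "\<lambda>i us p. local_form atlas c (ss ! i) p us" and b = "\<lambda>us p. local_form atlas c s p us"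
        and g = "\<lambda>i. (\<lambda>x. k x i) \<circ> cinv c"])
    let ?S = "cmap c ` (W \<inter> cdom c)"
    show "open ?S" by (rule open_cmap_image[OF c W(1)])
    show "smooth_on ?S (\<lambda>p. local_form atlas c (ss ! i) p us)"
      if "i \<in> {..<length ss}" "us \<in> {us. length us = n}" for i us
      using smooth_form_on_subset[OF ssD(2)[OF nth_mem] ssD(1) W(2), of i] that c
      by (simp add: smooth_form_on_def)
    show "smooth_on ?S (\<lambda>p. local_form atlas c s p us)" if "us \<in> {us. length us = n}" for us
      using s c that by (simp add: smooth_form_on_def)
    show "local_form atlas c s p us =
        (\<Sum>i<length ss. ((\<lambda>x. k x i) \<circ> cinv c) p * local_form atlas c (ss ! i) p us)"
      if "p \<in> ?S" for p us
      using that c k by (auto simp: local_form_def sum_scaleR_fun_apply)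
    show "m i = 0"
      if p: "p \<in> ?S" and m: "\<And>us. us \<in> {us. length us = n} \<Longrightarrow>
          (\<Sum>i<length ss. m i * local_form atlas c (ss ! i) p us) = 0" and i: "i \<in> {..<length ss}"
      for p m i
    proof -
      obtain x where x: "p = cmap c x" "x \<in> W" "x \<in> cdom c" using p by auto
      have "(\<Sum>i<length ss. m i *\<^sub>R (ss ! i) x) vs = 0" for vs
      proof (cases "length vs = n \<and> set vs \<subseteq> tangent_space atlas x")
        case True
        then show ?thesis
          using m[of "map (\<lambda>v. v c) vs"] form_eq_local_form[OF charts_atI[OF c x(3)], of vs] x
          by (simp add: sum_scaleR_fun_apply)
      next
        case False
        have "(ss ! i) x vs = 0" if "i < length ss" for i
        proof (rule alternating_forms_support[OF _ False])
          show "(ss ! i) x \<in> alternating_forms n (tangent_space atlas x)"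
            using ssD(2)[OF nth_mem[OF that]] x(2) W(2) by (auto simp: smooth_form_on_def)
        qed
        then show ?thesis by (simp add: sum_scaleR_fun_apply)
      qed
      then have "(\<Sum>i<length ss. m i *\<^sub>R (ss ! i) x) = 0" by (simp add: fun_eq_iff)
      then show "m i = 0"
        using independent_listD[OF pf(1,2)[OF x(2)], of m i] i by simp
    qed
  qed (use i in auto)
  then show ?thesis
    unfolding smooth_coefficients_def smooth_fun_on_def using k
    by (intro exI[of _ "\<lambda>i x. k x i"]) blast
qed

text \<open>The contractions of \<omega> with the coordinate fields of a chart. They show that the
  domains of \<open>admissible_frames\<close> cover the manifold.\<close>

lemma coord_frame:
  assumes c: "c \<in> atlas" and bs: "set bs = B" "distinct bs"
  shows "(cdom c, map (\<lambda>b x. coord_covector c x b) bs) \<in> admissible_frames atlas n \<omega>"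
  unfolding admissible_frames_def mem_Collect_eq prod.case
proof (intro conjI ballI)
  show "open (cdom c)" by (rule open_cdom[OF c])
  show "smooth_form_on atlas n (cdom c) s" if "s \<in> set (map (\<lambda>b x. coord_covector c x b) bs)" for s
    using that smooth_flat[OF open_cdom[OF c] smooth_coord_vector[OF c]]
    by (auto simp: interior_product_def)
  show "pointwise_frame fibre (cdom c) (map (\<lambda>b x. coord_covector c x b) bs)"
    unfolding pointwise_frame_def
  proof (intro ballI)
    fix x assume "x \<in> cdom c"
    then have cx: "c \<in> charts_at atlas x" using c by (simp add: charts_at_def)
    have m: "map (\<lambda>s. s x) (map (\<lambda>b x. coord_covector c x b) bs) = map (coord_covector c x) bs"
      by simp
    show "distinct (map (\<lambda>s. s x) (map (\<lambda>b x. coord_covector c x b) bs)) \<and>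
        independent (set (map (\<lambda>s. s x) (map (\<lambda>b x. coord_covector c x b) bs))) \<and>
        span (set (map (\<lambda>s. s x) (map (\<lambda>b x. coord_covector c x b) bs))) = fibre x"
      unfolding m distinct_map set_map bs(1)
      using bs(2) coord_covector_basis[OF cx] inj_coord_covector[OF cx]
      by (auto intro: inj_on_subset)
  qed
qed

lemma frame_at:
  obtains U ss where "(U, ss) \<in> admissible_frames atlas n \<omega>" "x \<in> U"
proof -
  obtain bs where "set bs = B" "distinct bs"
    using finite_distinct_list[OF orthonormal_basis_finite[OF basis]] by blast
  with coord_frame[of "chart_of atlas x" bs] chart_of_in[of x] show thesis
    by (auto simp: charts_at_def intro: that)
qed

lemma vector_bundle_admissible: "vector_bundle atlas fibre (admissible_frames atlas n \<omega>)"
  unfolding vector_bundle_def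
proof (intro conjI)
  show "\<exists>r. \<forall>x. dim (fibre x) = r" using dim_fibre by blast
  show "(\<Union>(U, ss)\<in>admissible_frames atlas n \<omega>. U) = UNIV"
  proof (intro equalityI subset_UNIV subsetI)
    fix x
    show "x \<in> (\<Union>(U, ss)\<in>admissible_frames atlas n \<omega>. U)"
      by (rule frame_at[of x]) blast
  qed
  show "\<forall>(U, ss)\<in>admissible_frames atlas n \<omega>. open U \<and> pointwise_frame fibre U ss"
    using admissible_framesD by blast
  have "smooth_coefficients atlas (U \<inter> V) ss t"
    if ss: "(U, ss) \<in> admissible_frames atlas n \<omega>"
      and ts: "(V, ts) \<in> admissible_frames atlas n \<omega>" and t: "t \<in> set ts" for U ss V ts t
    using admissible_framesD(1)[OF ss] admissible_framesD(1,2)[OF ts] t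
    by (intro smooth_coefficients_frame[OF ss]) (auto intro: smooth_form_on_subset frame_in_fibre[OF ts t])
  then show "\<forall>(U, ss)\<in>admissible_frames atlas n \<omega>. \<forall>(V, ts)\<in>admissible_frames atlas n \<omega>.
      \<forall>t\<in>set ts. smooth_coefficients atlas (U \<inter> V) ss t" by blast
qed

lemma bundle_map_sharp:
  "bundle_map_to_tangent atlas fibre (admissible_frames atlas n \<omega>) sharp"
proof -
  have "smooth_vector_field_on atlas U (\<lambda>x. sharp x (s x))"
    if "(U, ss) \<in> admissible_frames atlas n \<omega>" "s \<in> set ss" for U ss s
    by (rule smooth_sharp[OF admissible_framesD(1)[OF that(1)] admissible_framesD(2)[OF that]
          frame_in_fibre[OF that]])
  then show ?thesis
    unfolding bundle_map_to_tangent_def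
    by (intro conjI) (auto intro: sharp_in_tangent_space sharp_lincomb)
qed

text \<open>Sections are defined by coefficients in all frames, but calculations are done with
  vector fields. Smoothness of \<alpha> as a form is local and is read off from one frame around
  each point; \<open>smooth_sharp\<close> then gives the field. The converse combines
  \<open>smooth_flat\<close> with \<open>smooth_coefficients_frame\<close>.\<close>

lemma smooth_section_iff:
  "\<alpha> \<in> smooth_sections atlas fibre (admissible_frames atlas n \<omega>) \<longleftrightarrow>
    (\<exists>X. is_field X \<and> \<alpha> = flat X)"
proof
  assume \<alpha>: "\<alpha> \<in> smooth_sections atlas fibre (admissible_frames atlas n \<omega>)"
  then have F: "\<alpha> x \<in> fibre x" for x by (simp add: smooth_sections_def)
  have "smooth_form_on atlas n UNIV \<alpha>"
    unfolding smooth_form_on_def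
  proof (intro conjI ballI allI impI)
    show "\<alpha> x \<in> alternating_forms n (tangent_space atlas x)" for x
      using F[of x] contract_omega_alternating by (auto simp: admissible_fibre_def)
    fix c and us :: "'e list" assume c: "c \<in> atlas" and us: "length us = n"
    show "smooth_on (cmap c ` (UNIV \<inter> cdom c)) (\<lambda>p. local_form atlas c \<alpha> p us)"
    proof (rule smooth_on_local)
      fix p assume "p \<in> cmap c ` (UNIV \<inter> cdom c)"
      then obtain x where x: "p = cmap c x" "x \<in> cdom c" by auto
      obtain U ss where fr: "(U, ss) \<in> admissible_frames atlas n \<omega>" "x \<in> U" by (rule frame_at)
      note ssD = admissible_framesD[OF fr(1)]
      let ?S = "cmap c ` (U \<inter> cdom c)"
      have op: "open ?S" by (rule open_cmap_image[OF c ssD(1)])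
      obtain g where g: "\<And>i. i < length ss \<Longrightarrow> smooth_fun_on atlas U (g i)"
        "\<And>x. x \<in> U \<Longrightarrow> \<alpha> x = (\<Sum>i<length ss. g i x *\<^sub>R (ss ! i) x)"
        using \<alpha> fr(1) by (fastforce simp: smooth_sections_def smooth_coefficients_def)
      have "smooth_on ?S (\<lambda>p. \<Sum>i<length ss. g i (cinv c p) * local_form atlas c (ss ! i) p us)"
        using g(1) ssD(2)[OF nth_mem] c us
        by (intro smooth_on_sum smooth_on_mult op) (auto simp: smooth_fun_on_def smooth_form_on_def o_def)
      then have "smooth_on ?S (\<lambda>p. local_form atlas c \<alpha> p us)"
        by (rule smooth_on_cong[OF op])
           (use c g(2) in \<open>auto simp: local_form_def sum_scaleR_fun_apply\<close>)
      then show "\<exists>T. open T \<and> p \<in> T \<and> smooth_on T (\<lambda>p. local_form atlas c \<alpha> p us)"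
        using op x fr(2) by blast
    qed
  qed
  then have "is_field (\<lambda>x. sharp x (\<alpha> x))" by (intro smooth_sharp F) auto
  moreover have "\<alpha> = flat (\<lambda>x. sharp x (\<alpha> x))"
    using contract_sharp[OF F] by (auto simp: interior_product_def)
  ultimately show "\<exists>X. is_field X \<and> \<alpha> = flat X" by blast
next
  assume "\<exists>X. is_field X \<and> \<alpha> = flat X"
  then obtain X where X: "is_field X" "\<alpha> = flat X" by blast
  have F: "\<alpha> x \<in> fibre x" for x
    using X by (auto simp: interior_product_def admissible_fibre_def smooth_vector_field_on_def)
  have "smooth_coefficients atlas U ss \<alpha>" if "(U, ss) \<in> admissible_frames atlas n \<omega>" for U ss
    using smooth_form_on_subset[OF smooth_flat[OF open_UNIV X(1)]] X(2) F admissible_framesD(1)[OF that]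
    by (intro smooth_coefficients_frame[OF that]) auto
  then show "\<alpha> \<in> smooth_sections atlas fibre (admissible_frames atlas n \<omega>)"
    using F by (auto simp: smooth_sections_def)
qed


section \<open>The bracket of admissible forms\<close>

lemma admissible_field_flat:
  "is_field X \<Longrightarrow> admissible_field atlas \<omega> (flat X) = X"
  by (auto simp: admissible_field_def interior_product_def sharp_contract smooth_vector_field_on_def)

lemma local_flat:
  assumes "is_field X" "c \<in> atlas" "q \<in> cmap c ` cdom c"
  shows "local_form atlas c (interior_product X \<alpha>) q us = local_form atlas c \<alpha> q (X (cinv c q) c # us)"
proof -
  obtain x where "q = cmap c x" "x \<in> cdom c" using assms(3) by auto
  then show ?thesis
    using local_form_contract[OF charts_atI, of c x X \<alpha> us] assms(1,2)
    by (simp add: smooth_vector_field_on_def)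
qed

text \<open>At x, in the chart \<open>chart_of atlas x\<close> used by all operators of the bracket,
  this is \<open>coord_cartan_bracket\<close> for the coordinate expressions W, \<xi>, \<eta> of
  \<omega>, X, Y.\<close>

lemma omega_bracket_flat:
  assumes X: "is_field X" and Y: "is_field Y"
  shows "omega_bracket atlas \<omega> (flat X) (flat Y) = flat (field_bracket atlas X Y)"
proof (intro ext)
  fix x vs
  show "omega_bracket atlas \<omega> (flat X) (flat Y) x vs = flat (field_bracket atlas X Y) x vs"
  proof (cases "set vs \<subseteq> tangent_space atlas x")
    \<comment> \<open>An entry outside the tangent space gives 0 on both sides: by definition of
      \<open>lie_deriv\<close> and \<open>ext_deriv\<close>, and by the support of \<omega>.\<close>
    case False
    then have "flat (field_bracket atlas X Y) x vs = 0"
      using alternating_forms_support[OF contract_omega_alternating[OF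
            field_bracket_in_tangent_space[OF X Y]]] by (auto simp: interior_product_def)
    moreover have "omega_bracket atlas \<omega> (flat X) (flat Y) x vs = 0"
      using False by (simp add: omega_bracket_def Let_def lie_deriv_def ext_deriv_def)
    ultimately show ?thesis by simp
  next
    case True
    define c where "c = chart_of atlas x"
    have cx: "c \<in> charts_at atlas x" by (simp add: c_def chart_of_in)
    then have c: "c \<in> atlas" "x \<in> cdom c" by (auto simp: charts_at_def)
    define us where "us = map (\<lambda>v. v c) vs"
    define p where "p = cmap c x"
    define S where "S = cmap c ` cdom c"
    have S: "open S" "p \<in> S" using open_cmap_cdom c by (auto simp: S_def p_def)
    define W where "W = local_form atlas c \<omega>"
    define \<xi> where "\<xi> q = X (cinv c q) c" for q
    define \<eta> where "\<eta> q = Y (cinv c q) c" for q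
    have at_p: "\<xi> p = X x c" "\<eta> p = Y x c" using c by (auto simp: \<xi>_def \<eta>_def p_def)
    have lX: "local_form atlas c (interior_product X \<alpha>) q us = local_form atlas c \<alpha> q (\<xi> q # us)"
      and lY: "local_form atlas c (interior_product Y \<alpha>) q us = local_form atlas c \<alpha> q (\<eta> q # us)"
      if "q \<in> S" for q us \<alpha>
      using local_flat[OF X c(1)] local_flat[OF Y c(1)] that by (auto simp: S_def \<xi>_def \<eta>_def)
    have alt: "W q \<in> alternating_forms (Suc n) UNIV" if "q \<in> S" for q
      using alternating_local_omega[OF c(1)] that by (simp add: W_def S_def)
    \<comment> \<open>The length of vs is arbitrary here, so lists of the wrong length occur as
      well; on them W vanishes over the whole chart.\<close>
    have Wd: "(\<lambda>q. W q us) differentiable at p" for us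
    proof (cases "length us = Suc n")
      case True
      then show ?thesis
        using smooth_on_imp_differentiable[OF smooth_omega[OF c(1)]] S by (simp add: W_def S_def)
    next
      case False
      then have "0 = W q us" if "q \<in> S" for q
        using alternating_forms_support[OF alt[OF that]] by simp
      from fderiv_cong(2)[OF differentiable_const S this] show ?thesis .
    qed
    have Xd: "\<xi> differentiable at p" and Yd: "\<eta> differentiable at p"
      using differentiable_component[OF X cx] differentiable_component[OF Y cx]
      by (simp_all add: \<xi>_def[abs_def] \<eta>_def[abs_def] p_def)
    \<comment> \<open>d\<omega> = 0 is applied to the values of the fields at x followed by vs;
      their components in c are the entries of the coordinate identity.\<close>
    have "set (X x # Y x # vs) \<subseteq> tangent_space atlas x"
      using True X Y by (simp add: smooth_vector_field_on_def)
    then have closed: "(\<Sum>i<length (\<xi> p # \<eta> p # us). (-1) ^ i *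
        fderiv (\<lambda>q. W q (take i (\<xi> p # \<eta> p # us) @ drop (Suc i) (\<xi> p # \<eta> p # us))) p
          ((\<xi> p # \<eta> p # us) ! i)) = 0"
      using closed_omega[of x "X x # Y x # vs"] 
      unfolding ext_deriv_def Let_def c_def[symmetric] p_def[symmetric]
      by (simp only: if_True list.map at_p us_def W_def)
    have "lie_deriv atlas X (flat Y) x vs = fderiv (\<lambda>q. W q (\<eta> q # us)) p (\<xi> p)
        + (\<Sum>i<length us. W p (\<eta> p # us[i := fderiv \<xi> p (us ! i)]))"
    proof -
      have "fderiv (\<lambda>q. local_form atlas c (flat Y) q us) p = fderiv (\<lambda>q. W q (\<eta> q # us)) p"
        by (rule fderiv_cong_open[OF S]) (simp add: lY W_def)
      then show ?thesis
        unfolding lie_deriv_def Let_def c_def[symmetric] us_def[symmetric] p_def[symmetric]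
          \<xi>_def[symmetric]
        by (simp only: True if_True lY[OF S(2)] at_p W_def)
    qed
    moreover have "lie_deriv atlas Y (flat X) x vs = fderiv (\<lambda>q. W q (\<xi> q # us)) p (\<eta> p)
        + (\<Sum>i<length us. W p (\<xi> p # us[i := fderiv \<eta> p (us ! i)]))"
    proof -
      have "fderiv (\<lambda>q. local_form atlas c (flat X) q us) p = fderiv (\<lambda>q. W q (\<xi> q # us)) p"
        by (rule fderiv_cong_open[OF S]) (simp add: lX W_def)
      then show ?thesis
        unfolding lie_deriv_def Let_def c_def[symmetric] us_def[symmetric] p_def[symmetric]
          \<eta>_def[symmetric]
        by (simp only: True if_True lX[OF S(2)] at_p W_def)
    qed
    moreover have "ext_deriv atlas (interior_product X (flat Y)) x vs = (\<Sum>i<length us. (-1) ^ i *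
          fderiv (\<lambda>q. W q (\<eta> q # \<xi> q # take i us @ drop (Suc i) us)) p (us ! i))"
    proof -
      have "fderiv (\<lambda>q. local_form atlas c (interior_product X (flat Y)) q r) p =
          fderiv (\<lambda>q. W q (\<eta> q # \<xi> q # r)) p" for r
        by (rule fderiv_cong_open[OF S]) (simp add: lX lY W_def)
      then show ?thesis
        unfolding ext_deriv_def Let_def c_def[symmetric] us_def[symmetric] p_def[symmetric]
        by (simp only: True if_True)
    qed
    moreover have "flat (field_bracket atlas X Y) x vs = W p (coord_bracket \<xi> \<eta> p # us)"
      using form_eq_local_form[OF cx, of "field_bracket atlas X Y x # vs" \<omega>] True
        field_bracket_in_tangent_space[OF X Y] field_bracket_apply[OF cx, of X Y]
      by (simp add: interior_product_def contract_def W_def us_def p_def \<xi>_def[abs_def] \<eta>_def[abs_def])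
    ultimately show ?thesis
      using coord_cartan_bracket[OF basis S alt Wd Xd Yd closed]
      by (simp add: omega_bracket_def Let_def admissible_field_flat X Y)
  qed
qed

section \<open>Transport of the Lie algebroid axioms\<close>

lemma flat_lincomb:
  assumes "is_field X" "is_field Y"
  shows "flat (\<lambda>x. f x *\<^sub>R X x + g x *\<^sub>R Y x) = (\<lambda>x. f x *\<^sub>R flat X x + g x *\<^sub>R flat Y x)"
  using assms contract_omega_lincomb by (auto simp: interior_product_def smooth_vector_field_on_def)

lemma flat_zero: "flat (\<lambda>x. 0) = 0"
  by (auto simp: interior_product_def contract_omega_zero)

lemma lie_algebroid_admissible:
  "lie_algebroid atlas fibre (admissible_frames atlas n \<omega>) (omega_bracket atlas \<omega>) sharp"
  unfolding lie_algebroid_def Let_def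
proof (intro conjI vector_bundle_admissible bundle_map_sharp ballI allI impI)
  let ?\<Gamma> = "smooth_sections atlas fibre (admissible_frames atlas n \<omega>)"
  let ?br = "omega_bracket atlas \<omega>"
  have field: "\<exists>X. is_field X \<and> \<alpha> = flat X" if "\<alpha> \<in> ?\<Gamma>" for \<alpha>
    using that smooth_section_iff by blast
  fix \<alpha> \<beta> assume "\<alpha> \<in> ?\<Gamma>" "\<beta> \<in> ?\<Gamma>"
  then obtain X Y where X: "is_field X" "\<alpha> = flat X" and Y: "is_field Y" "\<beta> = flat Y"
    using field by blast
  have XY: "is_field (field_bracket atlas X Y)" by (rule smooth_field_bracket[OF X(1) Y(1)])
  show "?br \<alpha> \<beta> \<in> ?\<Gamma>"
    using XY omega_bracket_flat[OF X(1) Y(1)] X Y smooth_section_iff by blast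
  show "?br \<alpha> \<alpha> = 0"
  proof -
    have "field_bracket atlas X X = (\<lambda>x. 0)"
      by (intro ext) (simp add: field_bracket_def)
    then show ?thesis using omega_bracket_flat[OF X(1) X(1)] X(2) by (simp add: flat_zero)
  qed
  show "(\<lambda>x. sharp x (?br \<alpha> \<beta> x)) =
      field_bracket atlas (\<lambda>x. sharp x (\<alpha> x)) (\<lambda>x. sharp x (\<beta> x))"
    \<comment> \<open>As the anchor undoes \<open>flat\<close>, compatibility results from applying
      it to \<open>omega_bracket_flat\<close>.\<close>
    using admissible_field_flat[OF XY] admissible_field_flat[OF X(1)] admissible_field_flat[OF Y(1)]
    by (simp add: admissible_field_def X(2) Y(2) omega_bracket_flat[OF X(1) Y(1)])
  show "?br \<alpha> (\<lambda>x. f x *\<^sub>R \<beta> x) =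
      (\<lambda>x. f x *\<^sub>R ?br \<alpha> \<beta> x + tangent_deriv atlas x (sharp x (\<alpha> x)) f *\<^sub>R \<beta> x)"
    if f: "smooth_fun_on atlas UNIV f" for f
  proof -
    \<comment> \<open>Here \<open>flat\<close> has to be linear over functions and not only over the
      reals, hence the functions as coefficients in \<open>flat_lincomb\<close>; scaling is the case
      of a zero second coefficient.\<close>
    have "(\<lambda>x. f x *\<^sub>R \<beta> x) = flat (\<lambda>x. f x *\<^sub>R Y x)"
      using flat_lincomb[OF Y(1) Y(1), of f "\<lambda>x. 0"] Y(2) by simp
    then have "?br \<alpha> (\<lambda>x. f x *\<^sub>R \<beta> x) = flat (field_bracket atlas X (\<lambda>x. f x *\<^sub>R Y x))"
      using omega_bracket_flat[OF X(1) smooth_vector_field_on_scale[OF f Y(1)]] X(2) by simp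
    also have "\<dots> = flat (\<lambda>x. f x *\<^sub>R field_bracket atlas X Y x
        + tangent_deriv atlas x (X x) f *\<^sub>R Y x)"
      by (rule arg_cong[where f = "\<lambda>V. flat V"], rule ext) (rule field_bracket_leibniz[OF f X(1) Y(1)])
    also have "\<dots> = (\<lambda>x. f x *\<^sub>R flat (field_bracket atlas X Y) x
        + tangent_deriv atlas x (X x) f *\<^sub>R flat Y x)"
      by (rule flat_lincomb[OF XY Y(1)])
    also have "\<dots> = (\<lambda>x. f x *\<^sub>R ?br \<alpha> \<beta> x + tangent_deriv atlas x (sharp x (\<alpha> x)) f *\<^sub>R \<beta> x)"
      using fun_cong[OF admissible_field_flat[OF X(1)]] X(2) Y(2)
      by (simp add: omega_bracket_flat[OF X(1) Y(1)] admissible_field_def)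
    finally show ?thesis .
  qed
  fix \<gamma> assume "\<gamma> \<in> ?\<Gamma>"
  then obtain Z where Z: "is_field Z" "\<gamma> = flat Z" using field by blast
  \<comment> \<open>The axioms add and scale sections as functions, \<open>flat_lincomb\<close> does
    so at each point; \<open>lin\<close> and \<open>lin'\<close> pass between the two forms.\<close>
  have lin: "r *\<^sub>R \<alpha> + s *\<^sub>R \<beta> = flat (\<lambda>x. r *\<^sub>R X x + s *\<^sub>R Y x)" for r s
    using flat_lincomb[OF X(1) Y(1), of "\<lambda>x. r" "\<lambda>x. s"] X(2) Y(2)
    by (simp add: fun_eq_iff scaleR_fun_def)
  have lin': "flat (\<lambda>x. r *\<^sub>R V x + s *\<^sub>R V' x) = r *\<^sub>R flat V + s *\<^sub>R flat V'"
    if "is_field V" "is_field V'" for V V' r s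
    using flat_lincomb[OF that, of "\<lambda>x. r" "\<lambda>x. s"] by (simp add: fun_eq_iff scaleR_fun_def)
  show "?br (r *\<^sub>R \<alpha> + s *\<^sub>R \<beta>) \<gamma> = r *\<^sub>R ?br \<alpha> \<gamma> + s *\<^sub>R ?br \<beta> \<gamma>" for r s
  proof -
    have "?br (r *\<^sub>R \<alpha> + s *\<^sub>R \<beta>) \<gamma> =
        flat (field_bracket atlas (\<lambda>x. r *\<^sub>R X x + s *\<^sub>R Y x) Z)"
      unfolding lin Z(2)
      by (rule omega_bracket_flat[OF smooth_vector_field_on_lincomb[OF X(1) Y(1)] Z(1)])
    also have "\<dots> = flat (\<lambda>x. r *\<^sub>R field_bracket atlas X Z x + s *\<^sub>R field_bracket atlas Y Z x)"
      by (rule arg_cong[where f = "\<lambda>V. flat V"], rule ext) (rule field_bracket_lincomb_left[OF X(1) Y(1) Z(1)])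
    finally show ?thesis
      by (simp add: lin' smooth_field_bracket X Y Z omega_bracket_flat)
  qed
  show "?br \<gamma> (r *\<^sub>R \<alpha> + s *\<^sub>R \<beta>) = r *\<^sub>R ?br \<gamma> \<alpha> + s *\<^sub>R ?br \<gamma> \<beta>" for r s
  proof -
    have "?br \<gamma> (r *\<^sub>R \<alpha> + s *\<^sub>R \<beta>) =
        flat (field_bracket atlas Z (\<lambda>x. r *\<^sub>R X x + s *\<^sub>R Y x))"
      unfolding lin Z(2)
      by (rule omega_bracket_flat[OF Z(1) smooth_vector_field_on_lincomb[OF X(1) Y(1)]])
    also have "\<dots> = flat (\<lambda>x. r *\<^sub>R field_bracket atlas Z X x + s *\<^sub>R field_bracket atlas Z Y x)"
      by (rule arg_cong[where f = "\<lambda>V. flat V"], rule ext) (rule field_bracket_lincomb_right[OF X(1) Y(1) Z(1)])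
    finally show ?thesis
      by (simp add: lin' smooth_field_bracket X Y Z omega_bracket_flat)
  qed
  show "?br \<alpha> (?br \<beta> \<gamma>) + ?br \<beta> (?br \<gamma> \<alpha>) + ?br \<gamma> (?br \<alpha> \<beta>) = 0"
  proof -
    let ?f = "field_bracket atlas"
    have "?br \<alpha> (?br \<beta> \<gamma>) + ?br \<beta> (?br \<gamma> \<alpha>) + ?br \<gamma> (?br \<alpha> \<beta>) =
        flat (?f X (?f Y Z)) + flat (?f Y (?f Z X)) + flat (?f Z (?f X Y))"
      by (simp add: X Y Z omega_bracket_flat smooth_field_bracket)
    also have "\<dots> = flat (\<lambda>x. ?f X (?f Y Z) x + ?f Y (?f Z X) x + ?f Z (?f X Y) x)"
    proof -
      have add: "flat (\<lambda>x. V x + V' x) = flat V + flat V'" if "is_field V" "is_field V'" for V V'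
        using lin'[OF that, of 1 1] by simp
      have "is_field (\<lambda>x. ?f X (?f Y Z) x + ?f Y (?f Z X) x)"
        using smooth_vector_field_on_lincomb[of "?f X (?f Y Z)" "?f Y (?f Z X)" 1 1]
        by (simp add: X Y Z smooth_field_bracket)
      then show ?thesis by (simp add: add X Y Z smooth_field_bracket)
    qed
    also have "\<dots> = 0"
      by (simp add: field_bracket_jacobi X Y Z flat_zero)
    finally show ?thesis .
  qed
qed

end

theorem theorem4p8:
  fixes atlas :: "('a::{t2_space,second_countable_topology}, 'e::real_inner) chart set"
    and \<omega> :: "('a, 'e) dform"
    and n :: nat
  assumes "smooth_manifold atlas"
    and "1 \<le> n"
    and "n_plectic atlas n \<omega>"
  shows "lie_algebroid atlas (admissible_fibre atlas \<omega>) (admissible_frames atlas n \<omega>)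
    (omega_bracket atlas \<omega>) (omega_sharp atlas \<omega>)"
proof -
  \<comment> \<open>The finite spanning set in the definition of a manifold yields, by
    orthogonalisation, the basis that the locale fixes.\<close>
  obtain A :: "'e set" where "finite A" "span A = UNIV"
    using assms(1) by (auto simp: smooth_manifold_def)
  then obtain B :: "'e set" where "orthonormal_basis B"
    by (rule orthonormal_basis_exists)
  then interpret n_plectic_manifold atlas B \<omega> n
    by unfold_locales (use assms in auto)
  show ?thesis by (rule lie_algebroid_admissible)
qed

end
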